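(* Let $F=F(u,q):\mathbb{R}^2\to\mathbb{R}$ be real-analytic and uniformly elliptic, i.e. there is $\delta>0$ with $F_q(u,q)\ge \delta$ for all $(u,q)\in\mathbb{R}^2$. Let $u$ be a non-constant (real-analytic) solution of $$0=F(u,\Delta_{\mathbb{S}^2}u)\quad\text{on } \mathbb{S}^2,$$ written $u=u(\theta,\phi)$ in spherical coordinates. Suppose that all extrema of $u$ are axial, occurring at the finitely many angles $\phi_1<\phi_2<\dots<\phi_N$ (within one period of length $2\pi$), and that they are leveled. Set $\phi_0:=\phi_N-2\pi$ and $\phi_{N+1}:=\phi_1+2\pi$ (so that $\phi_0=\phi_N$ and $\phi_{N+1}=\phi_1$ as angles). Then, for all $i=1,\dots,N$, $$\phi_i=\frac{\phi_{i-1}+\phi_{i+1}}{2}$$ and $$u(\theta,\phi)=u(\theta,R_{\phi_i}(\phi))\qquad\text{for all }(\theta,\phi)\in[0,\pi]\times[\phi_{i-1},\phi_i],$$ where $R_{\phi_i}(\phi):=2\phi_i-\phi$.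
   Context: $\mathbb{S}^2$ is the unit round sphere with Laplace-Beltrami operator $\Delta_{\mathbb{S}^2}$. Coordinates: $\theta\in[0,\pi]$ is the polar angle (geodesic distance from the north pole) and $\phi$ is the azimuthal angle, with all functions $2\pi$-periodic in $\phi$. $F_q$ denotes the partial derivative of $F$ in its second argument, where $q=\Delta_{\mathbb{S}^2}u$. Axial extrema: $u$ has (only) axial extrema if whenever $u_\phi(\theta_0,\phi_0)=0$ for some point $(\theta_0,\phi_0)$ with $\theta_0\in(0,\pi)$, then $u_\phi(\theta,\phi_0)=0$ for all $\theta\in[0,\pi]$. The angles $\phi_0$ (mod $2\pi$) for which this occurs are called the axial extrema of $u$; they are assumed to be finitely many and are listed in increasing order over one period as $\{\phi_i\}_{i=1}^N$. An axial extremum $\phi_i$ is an axial maximum (respectively axial minimum) if $\phi\mapsto u(\theta,\phi)$ has a local maximum (respectively minimum) at $\phi_i$ for each $\theta$. Leveled: the axial extrema are leveled if there are functions $M(\theta)$ and $m(\theta)$ such that every axial maximum $\phi_j$ satisfies $u(\theta,\phi_j)=M(\theta)$ for all $\theta\in[0,\pi]$ and every axial minimum $\phi_k$ satisfies $u(\theta,\phi_k)=m(\theta)$ for all $\theta\in[0,\pi]$. *)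

theory Defs
  imports "HOL-Analysis.Analysis"
begin

text \<open>
  The multi-indices are the extensional functions from the standard basis to the natural numbers;
  unconditional summability is absolute convergence. For open \<open>S\<close> (in particular
  \<open>UNIV\<close>) this is the usual notion. For a submanifold such as the sphere it says that
  \<open>f\<close> is locally the restriction of a real-analytic function on the ambient space.
\<close>

definition power_series_term ::
    "(('a::euclidean_space \<Rightarrow> nat) \<Rightarrow> real) \<Rightarrow> 'a \<Rightarrow> ('a \<Rightarrow> nat) \<Rightarrow> real" where
  "power_series_term c h \<alpha> = c \<alpha> * (\<Prod>b\<in>Basis. (h \<bullet> b) ^ \<alpha> b)"

definition real_analytic_on :: "('a::euclidean_space \<Rightarrow> real) \<Rightarrow> 'a set \<Rightarrow> bool" where
  "real_analytic_on f S \<longleftrightarrow>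
     (\<forall>x\<in>S. \<exists>c. \<exists>r>0. \<forall>y\<in>ball x r.
        power_series_term c (y - x) summable_on (Basis \<rightarrow>\<^sub>E UNIV) \<and>
        (y \<in> S \<longrightarrow> (power_series_term c (y - x) has_sum f y) (Basis \<rightarrow>\<^sub>E UNIV)))"

text \<open>
  Functions and vector fields on the unit sphere are represented by functions on the ambient space
  of which only the values on the sphere matter: they are differentiated after composition with the
  radial projection \<^const>\<open>sgn\<close>, \<open>y \<mapsto> y / |y|\<close>. At a point \<open>x\<close> of the sphere the
  derivative of such a composition vanishes in the normal direction \<open>x\<close> and is the intrinsic
  derivative in tangential directions. Hence the gradient below is the Riemannian gradient
  (which is tangential), and the trace over the ambient basis equals the trace over the tangent
  space, i.e. for tangential \<open>X\<close> the Riemannian divergence (the normal part of the ambient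
  derivative of \<open>X\<close> is orthogonal to the tangent space, so it does not contribute).
\<close>

definition sphere_grad :: "('a::euclidean_space \<Rightarrow> real) \<Rightarrow> 'a \<Rightarrow> 'a" where
  "sphere_grad u x = (\<Sum>b\<in>Basis. frechet_derivative (\<lambda>y. u (sgn y)) (at x) b *\<^sub>R b)"

definition sphere_div :: "('a::euclidean_space \<Rightarrow> 'a) \<Rightarrow> 'a \<Rightarrow> real" where
  "sphere_div X x = (\<Sum>b\<in>Basis. frechet_derivative (\<lambda>y. X (sgn y)) (at x) b \<bullet> b)"

definition laplace_beltrami :: "('a::euclidean_space \<Rightarrow> real) \<Rightarrow> 'a \<Rightarrow> real" where
  "laplace_beltrami u = sphere_div (sphere_grad u)"

definition spherical :: "real \<Rightarrow> real \<Rightarrow> real^3" where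
  "spherical \<theta> \<phi> = vector [sin \<theta> * cos \<phi>, sin \<theta> * sin \<phi>, cos \<theta>]"

definition deriv_azimuth :: "(real^3 \<Rightarrow> real) \<Rightarrow> real \<Rightarrow> real \<Rightarrow> real" where
  "deriv_azimuth u \<theta> \<phi> = deriv (\<lambda>\<psi>. u (spherical \<theta> \<psi>)) \<phi>"

definition only_axial_extrema :: "(real^3 \<Rightarrow> real) \<Rightarrow> bool" where
  "only_axial_extrema u \<longleftrightarrow>
     (\<forall>\<theta>\<^sub>0 \<in> {0<..<pi}. \<forall>\<phi>\<^sub>0. deriv_azimuth u \<theta>\<^sub>0 \<phi>\<^sub>0 = 0 \<longrightarrow>
        (\<forall>\<theta>\<in>{0..pi}. deriv_azimuth u \<theta> \<phi>\<^sub>0 = 0))"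

definition axial_extremum :: "(real^3 \<Rightarrow> real) \<Rightarrow> real \<Rightarrow> bool" where
  "axial_extremum u \<phi>\<^sub>0 \<longleftrightarrow> (\<forall>\<theta>\<in>{0..pi}. deriv_azimuth u \<theta> \<phi>\<^sub>0 = 0)"

definition axial_maximum :: "(real^3 \<Rightarrow> real) \<Rightarrow> real \<Rightarrow> bool" where
  "axial_maximum u \<phi>\<^sub>0 \<longleftrightarrow> axial_extremum u \<phi>\<^sub>0 \<and>
     (\<forall>\<theta>\<in>{0..pi}. \<forall>\<^sub>F \<phi> in nhds \<phi>\<^sub>0. u (spherical \<theta> \<phi>) \<le> u (spherical \<theta> \<phi>\<^sub>0))"

definition axial_minimum :: "(real^3 \<Rightarrow> real) \<Rightarrow> real \<Rightarrow> bool" where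
  "axial_minimum u \<phi>\<^sub>0 \<longleftrightarrow> axial_extremum u \<phi>\<^sub>0 \<and>
     (\<forall>\<theta>\<in>{0..pi}. \<forall>\<^sub>F \<phi> in nhds \<phi>\<^sub>0. u (spherical \<theta> \<phi>) \<ge> u (spherical \<theta> \<phi>\<^sub>0))"

definition leveled :: "(real^3 \<Rightarrow> real) \<Rightarrow> bool" where
  "leveled u \<longleftrightarrow> (\<exists>M m :: real \<Rightarrow> real.
     (\<forall>\<psi>. axial_maximum u \<psi> \<longrightarrow> (\<forall>\<theta>\<in>{0..pi}. u (spherical \<theta> \<psi>) = M \<theta>)) \<and>
     (\<forall>\<psi>. axial_minimum u \<psi> \<longrightarrow> (\<forall>\<theta>\<in>{0..pi}. u (spherical \<theta> \<psi>) = m \<theta>)))"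

text \<open>
  \<open>\<phi> 1 < \<dots> < \<phi> N\<close> lie within one period and represent all axial extrema modulo \<open>2\<pi>\<close>
  (in particular there are only finitely many of these); \<open>\<phi> 0\<close> and \<open>\<phi> (N + 1)\<close> continue the list
  periodically by one step on either side.
\<close>

definition enumerates_axial_extrema ::
    "(real^3 \<Rightarrow> real) \<Rightarrow> nat \<Rightarrow> (nat \<Rightarrow> real) \<Rightarrow> bool" where
  "enumerates_axial_extrema u N \<phi> \<longleftrightarrow>
     strict_mono_on {1..N} \<phi> \<and> \<phi> N < \<phi> 1 + 2 * pi \<and>
     {\<psi>. axial_extremum u \<psi>} = {\<phi> i + 2 * pi * of_int k | i (k::int). i \<in> {1..N}} \<and>
     \<phi> 0 = \<phi> N - 2 * pi \<and> \<phi> (N + 1) = \<phi> 1 + 2 * pi"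

end

theory Submission
  imports Defs "HOL-Complex_Analysis.Complex_Analysis"
begin

text \<open>
  On the meridian of an axial extremum the azimuthal derivative of \<open>u\<close> vanishes, so \<open>u\<close> and its
  mirror image have the same Cauchy data there, and by ellipticity the meridian is not
  characteristic. Uniqueness for the Cauchy problem then makes \<open>u\<close> symmetric about the meridian;
  hence the set of axial extrema is symmetric too, and \<open>\<phi> i\<close> is the midpoint of its neighbours.

  For the uniqueness, extend \<open>u\<close> to a \<open>0\<close>-homogeneous function \<open>U\<close> on the punctured space, whose
  Euclidean Laplacian restricts to the Laplace-Beltrami operator. Suppose the odd normal
  derivatives of \<open>U\<close> of order below \<open>k\<close> vanish on the half plane of the meridian. The equation
  bounds the odd part of the Laplacian along a normal line by the odd part of \<open>U\<close>, which is
  \<open>O(s^k)\<close>; the tangential second derivatives contribute \<open>O(s^k)\<close> as well, whereas the odd part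
  of the second normal derivative is \<open>s^(k-2)\<close> times a multiple of the normal derivative of order
  \<open>k\<close>, which therefore vanishes. So the odd part of \<open>u\<close> along great circles orthogonal to the
  meridian is flat, and being analytic it is zero.
\<close>

section \<open>Iterated directional derivatives\<close>

text \<open>Straight lines in the ambient space, in place of the coordinates (\<theta>, \<phi>),
  avoid the singular poles and give a Laplacian with constant coefficients, whose normal and
  tangential derivatives commute. The price is a factor |y|^2 between the two Laplacians; it is
  harmless since p + s n and p - s n have the same norm. Instead of solving the equation for q, the
  proof uses that ellipticity makes the zero set of F locally a Lipschitz graph over u: a Lipschitz
  bound on odd differences is all that comparing orders in s requires. Central projection takes the
  line p + s n to half of a great circle, with s = tan t, so flatness in s is flatness in t; the
  other half is reached only by analytic continuation. These circles reach every point off the plane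
  orthogonal to \<open>equatorial \<phi>\<close>; on that plane the poles are fixed by the
  reflection and continuity settles the rest.\<close>

definition dir_deriv :: "'a::real_normed_vector \<Rightarrow> ('a \<Rightarrow> real) \<Rightarrow> 'a \<Rightarrow> real" where
  "dir_deriv v f x = frechet_derivative f (at x) v"

text \<open>All derivatives are ambient ones \<open>at x\<close>, not within \<open>S\<close>: the
  set only tells where they are demanded. Hence the notion is pointwise in \<open>S\<close> and
  makes sense even for a singleton, which lets smoothness be checked locally.\<close>

primrec times_differentiable_on ::
    "nat \<Rightarrow> ('a::real_normed_vector \<Rightarrow> real) \<Rightarrow> 'a set \<Rightarrow> bool" where
  "times_differentiable_on 0 f S \<longleftrightarrow> True"
| "times_differentiable_on (Suc n) f S \<longleftrightarrow>
     (\<forall>x\<in>S. f differentiable at x) \<and> (\<forall>v. times_differentiable_on n (dir_deriv v f) S)"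

definition smooth_on :: "('a::real_normed_vector \<Rightarrow> real) \<Rightarrow> 'a set \<Rightarrow> bool" where
  "smooth_on f S \<longleftrightarrow> (\<forall>n. times_differentiable_on n f S)"

lemma dir_deriv_eqI: "(f has_derivative f') (at x) \<Longrightarrow> dir_deriv v f x = f' v"
  unfolding dir_deriv_def using frechet_derivative_at by metis

lemma has_derivative_dir_deriv:
  "f differentiable at x \<Longrightarrow> (f has_derivative (\<lambda>v. dir_deriv v f x)) (at x)"
  unfolding dir_deriv_def by (simp add: frechet_derivative_works[symmetric])

lemma linear_dir_deriv: "f differentiable at x \<Longrightarrow> linear (\<lambda>v. dir_deriv v f x)"
  unfolding dir_deriv_def by (simp add: linear_frechet_derivative)

lemma dir_deriv_cong:
  assumes "open S" "x \<in> S" "\<And>y. y \<in> S \<Longrightarrow> f y = g y"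
  shows "dir_deriv v f x = dir_deriv v g x"
proof -
  have "(f has_derivative D) (at x) \<longleftrightarrow> (g has_derivative D) (at x)" for D
    using assms by (metis has_derivative_transform_within_open)
  then show ?thesis
    unfolding dir_deriv_def frechet_derivative_def by simp
qed

lemma differentiable_cong_open:
  assumes "open S" "x \<in> S" "\<And>y. y \<in> S \<Longrightarrow> f y = g y" "f differentiable at x"
  shows "g differentiable at x"
  using assms unfolding differentiable_def by (metis has_derivative_transform_within_open)

lemma times_differentiable_on_cong:
  assumes "open S" "\<And>y. y \<in> S \<Longrightarrow> f y = g y" "times_differentiable_on n f S"
  shows "times_differentiable_on n g S"
  using assms(2,3)
proof (induction n arbitrary: f g)
  case (Suc n)
  have "times_differentiable_on n (dir_deriv v g) S" for v
    using Suc.IH[of "dir_deriv v f"] Suc.prems dir_deriv_cong[OF assms(1)]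
    by (metis times_differentiable_on.simps(2))
  then show ?case
    using Suc.prems differentiable_cong_open[OF assms(1)] by (metis times_differentiable_on.simps(2))
qed simp

lemma times_differentiable_on_SucD:
  "times_differentiable_on (Suc n) f S \<Longrightarrow> times_differentiable_on n f S"
  by (induction n arbitrary: f) auto

lemma times_differentiable_on_mono:
  "times_differentiable_on n f S \<Longrightarrow> T \<subseteq> S \<Longrightarrow> times_differentiable_on n f T"
  by (induction n arbitrary: f) auto

lemma times_differentiable_on_pointwise:
  "times_differentiable_on n f S \<longleftrightarrow> (\<forall>x\<in>S. times_differentiable_on n f {x})"
  by (induction n arbitrary: f) auto

lemma smooth_on_cong:
  assumes "open S" "\<And>y. y \<in> S \<Longrightarrow> f y = g y" "smooth_on f S"
  shows "smooth_on g S"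
  using assms times_differentiable_on_cong unfolding smooth_on_def by metis

lemma smooth_on_subset: "smooth_on f S \<Longrightarrow> T \<subseteq> S \<Longrightarrow> smooth_on f T"
  unfolding smooth_on_def using times_differentiable_on_mono by metis

lemma smooth_on_pointwise: "smooth_on f S \<longleftrightarrow> (\<forall>x\<in>S. smooth_on f {x})"
  unfolding smooth_on_def using times_differentiable_on_pointwise by metis

lemma smooth_on_imp_differentiable: "smooth_on f S \<Longrightarrow> x \<in> S \<Longrightarrow> f differentiable at x"
  unfolding smooth_on_def by (metis times_differentiable_on.simps(2))

lemma smooth_on_dir_deriv: "smooth_on f S \<Longrightarrow> smooth_on (dir_deriv v f) S"
  unfolding smooth_on_def by (metis times_differentiable_on.simps(2))

lemma smooth_on_dir_deriv_funpow: "smooth_on f S \<Longrightarrow> smooth_on ((dir_deriv v ^^ k) f) S"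
  by (induction k) (auto intro: smooth_on_dir_deriv)

lemma smooth_on_imp_continuous_on: "smooth_on f S \<Longrightarrow> continuous_on S f"
  by (meson continuous_at_imp_continuous_on differentiable_imp_continuous_within
      smooth_on_imp_differentiable)

section \<open>Closure of smoothness under algebra and composition\<close>

lemma times_differentiable_on_const: "times_differentiable_on n (\<lambda>x. c) S"
proof (induction n arbitrary: c)
  case (Suc n)
  have "dir_deriv v (\<lambda>x::'a. c) = (\<lambda>x. 0)" for v
    by (simp add: dir_deriv_def fun_eq_iff)
  then show ?case using Suc by simp
qed simp

lemma times_differentiable_on_add:
  assumes "open S" "times_differentiable_on n f S" "times_differentiable_on n g S"
  shows "times_differentiable_on n (\<lambda>x. f x + g x) S"
  using assms(2,3)
proof (induction n arbitrary: f g)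
  case (Suc n)
  have d: "dir_deriv v f x + dir_deriv v g x = dir_deriv v (\<lambda>x. f x + g x) x" if "x \<in> S" for v x
    using that Suc.prems
    by (intro dir_deriv_eqI[symmetric] has_derivative_add) (auto intro: has_derivative_dir_deriv)
  have "times_differentiable_on n (dir_deriv v (\<lambda>x. f x + g x)) S" for v
    by (rule times_differentiable_on_cong[OF assms(1) d Suc.IH]) (use Suc.prems in auto)
  then show ?case using Suc.prems by auto
qed simp

lemma times_differentiable_on_mult:
  assumes "open S" "times_differentiable_on n f S" "times_differentiable_on n g S"
  shows "times_differentiable_on n (\<lambda>x. f x * g x) S"
  using assms(2,3)
proof (induction n arbitrary: f g)
  case (Suc n)
  have d: "f x * dir_deriv v g x + dir_deriv v f x * g x = dir_deriv v (\<lambda>x. f x * g x) x"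
    if "x \<in> S" for v x
    using that Suc.prems
    by (intro dir_deriv_eqI[symmetric] has_derivative_mult) (auto intro: has_derivative_dir_deriv)
  have "times_differentiable_on n (dir_deriv v (\<lambda>x. f x * g x)) S" for v
    by (rule times_differentiable_on_cong[OF assms(1) d times_differentiable_on_add[OF assms(1)]])
      (use Suc.prems times_differentiable_on_SucD[OF Suc.prems(1)]
         times_differentiable_on_SucD[OF Suc.prems(2)] in \<open>auto intro: Suc.IH\<close>)
  then show ?case using Suc.prems by auto
qed simp

lemma times_differentiable_on_sum:
  assumes "open S" "\<And>i. i \<in> I \<Longrightarrow> times_differentiable_on n (f i) S"
  shows "times_differentiable_on n (\<lambda>x. \<Sum>i\<in>I. f i x) S"
  using assms(2)
  by (induction I rule: infinite_finite_induct)
    (auto intro: times_differentiable_on_const times_differentiable_on_add[OF assms(1)])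

lemma times_differentiable_on_inner: "times_differentiable_on n (\<lambda>x. x \<bullet> b) S"
proof (cases n)
  case (Suc m)
  have "dir_deriv v (\<lambda>x. x \<bullet> b) = (\<lambda>x. v \<bullet> b)" for v
    by (intro ext dir_deriv_eqI) (auto intro!: derivative_eq_intros)
  then show ?thesis
    using Suc times_differentiable_on_const by auto
qed simp

text \<open>Differentiating lowers the exponent by one and produces a factor linear in x, so the
  induction has to run over all exponents at once. The exponent -1/2 gives 1/|x| and with it
  smoothness of the radial projection.\<close>

lemma times_differentiable_on_norm_power:
  fixes S :: "'a::real_inner set"
  assumes "open S" "0 \<notin> S"
  shows "times_differentiable_on n (\<lambda>x. (x \<bullet> x) powr a) S"
proof (induction n arbitrary: a)
  case (Suc n)
  have D: "((\<lambda>x. (x \<bullet> x) powr a) has_derivative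
      (\<lambda>v. (2 * a) * ((x \<bullet> x) powr (a - 1) * (x \<bullet> v)))) (at x)" if "x \<in> S" for x
  proof -
    have "x \<bullet> x > 0" using that assms by auto
    then show ?thesis
      by (auto intro!: derivative_eq_intros simp: powr_diff inner_commute field_simps fun_eq_iff)
  qed
  have d: "(2 * a) * ((x \<bullet> x) powr (a - 1) * (x \<bullet> v)) = dir_deriv v (\<lambda>x. (x \<bullet> x) powr a) x"
    if "x \<in> S" for x v
    using dir_deriv_eqI[OF D[OF that]] by simp
  have "times_differentiable_on n (dir_deriv v (\<lambda>x. (x \<bullet> x) powr a)) S" for v
    by (rule times_differentiable_on_cong[OF assms(1) d], assumption)
      (intro times_differentiable_on_mult[OF assms(1)] times_differentiable_on_const Suc.IH
        times_differentiable_on_inner)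
  then show ?case using D by (auto simp: differentiable_def)
qed simp

text \<open>The chain rule writes each derivative of the composite as a sum of products of a
  derivative of a component of g with \<open>dir_deriv b f\<close> after g. The first factor is
  smooth and the second is covered by the induction hypothesis, so n counts derivatives of f only
  while g has all orders.\<close>

lemma times_differentiable_on_compose:
  fixes f :: "'a::euclidean_space \<Rightarrow> real" and g :: "'b::real_normed_vector \<Rightarrow> 'a"
  assumes S: "open S" and sub: "g ` S \<subseteq> T"
    and g: "\<And>b. b \<in> Basis \<Longrightarrow> smooth_on (\<lambda>x. g x \<bullet> b) S"
    and f: "times_differentiable_on n f T"
  shows "times_differentiable_on n (\<lambda>x. f (g x)) S"
  using f
proof (induction n arbitrary: f)
  case (Suc n)
  have D: "((\<lambda>x. f (g x)) has_derivative
      (\<lambda>v. \<Sum>b\<in>Basis. dir_deriv v (\<lambda>x. g x \<bullet> b) x * dir_deriv b f (g x))) (at x)"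
    if "x \<in> S" for x
  proof -
    have fd: "f differentiable at (g x)" using Suc.prems sub that by auto
    have "(g has_derivative (\<lambda>v. \<Sum>b\<in>Basis. dir_deriv v (\<lambda>x. g x \<bullet> b) x *\<^sub>R b)) (at x)"
      by (subst has_derivative_componentwise_within)
        (auto simp: inner_sum_left inner_Basis if_distrib cong: if_cong
          intro!: has_derivative_dir_deriv smooth_on_imp_differentiable[OF g that])
    then have "((\<lambda>x. f (g x)) has_derivative
      (\<lambda>v. dir_deriv (\<Sum>b\<in>Basis. dir_deriv v (\<lambda>x. g x \<bullet> b) x *\<^sub>R b) f (g x))) (at x)"
      by (rule has_derivative_compose) (rule has_derivative_dir_deriv[OF fd])
    also have "(\<lambda>v. dir_deriv (\<Sum>b\<in>Basis. dir_deriv v (\<lambda>x. g x \<bullet> b) x *\<^sub>R b) f (g x)) =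
      (\<lambda>v. \<Sum>b\<in>Basis. dir_deriv v (\<lambda>x. g x \<bullet> b) x * dir_deriv b f (g x))"
      by (simp add: linear_sum[OF linear_dir_deriv[OF fd]] linear_cmul[OF linear_dir_deriv[OF fd]])
    finally show ?thesis .
  qed
  have d: "(\<Sum>b\<in>Basis. dir_deriv v (\<lambda>x. g x \<bullet> b) x * dir_deriv b f (g x)) =
      dir_deriv v (\<lambda>x. f (g x)) x" if "x \<in> S" for x v
    using dir_deriv_eqI[OF D[OF that]] by simp
  have "times_differentiable_on n (dir_deriv v (\<lambda>x. f (g x))) S" for v
  proof (rule times_differentiable_on_cong[OF S d])
    have "times_differentiable_on n (dir_deriv v (\<lambda>x. g x \<bullet> b)) S" if "b \<in> Basis" for b
      using smooth_on_dir_deriv[OF g[OF that]] unfolding smooth_on_def by blast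
    moreover have "times_differentiable_on n (\<lambda>x. dir_deriv b f (g x)) S" for b
      using Suc by simp
    ultimately show "times_differentiable_on n
        (\<lambda>x. \<Sum>b\<in>Basis. dir_deriv v (\<lambda>x. g x \<bullet> b) x * dir_deriv b f (g x)) S"
      by (intro times_differentiable_on_sum[OF S] times_differentiable_on_mult[OF S])
  qed
  then show ?case using D by (auto simp: differentiable_def)
qed simp

lemma smooth_on_compose:
  fixes f :: "'a::euclidean_space \<Rightarrow> real" and g :: "'b::real_normed_vector \<Rightarrow> 'a"
  assumes "open S" "g ` S \<subseteq> T" "\<And>b. b \<in> Basis \<Longrightarrow> smooth_on (\<lambda>x. g x \<bullet> b) S" "smooth_on f T"
  shows "smooth_on (\<lambda>x. f (g x)) S"
  using times_differentiable_on_compose[OF assms(1-3)] assms(4) unfolding smooth_on_def by blast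

lemma has_real_derivative_along_line:
  assumes "f differentiable at (x + s *\<^sub>R v)"
  shows "((\<lambda>s. f (x + s *\<^sub>R v)) has_real_derivative dir_deriv v f (x + s *\<^sub>R v)) (at s)"
proof -
  have "((\<lambda>s. x + s *\<^sub>R v) has_derivative (\<lambda>t. t *\<^sub>R v)) (at s)"
    by (auto intro!: derivative_eq_intros)
  then have "((\<lambda>s. f (x + s *\<^sub>R v)) has_derivative (\<lambda>t. dir_deriv (t *\<^sub>R v) f (x + s *\<^sub>R v))) (at s)"
    by (rule has_derivative_compose) (rule has_derivative_dir_deriv[OF assms])
  moreover have "(\<lambda>t. dir_deriv (t *\<^sub>R v) f (x + s *\<^sub>R v)) = (*) (dir_deriv v f (x + s *\<^sub>R v))"
    using linear_cmul[OF linear_dir_deriv[OF assms]] by (simp add: fun_eq_iff)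
  ultimately show ?thesis by (simp add: has_field_derivative_def)
qed

text \<open>Two applications of the mean value theorem, first along v, then along w. The second
  difference is symmetric in v and w, which is what forces mixed derivatives to agree.\<close>

lemma second_difference_mean_value:
  assumes S: "open S" and f: "smooth_on f S" and s: "s > 0"
    and sub: "\<And>a b. 0 \<le> a \<Longrightarrow> a \<le> s \<Longrightarrow> 0 \<le> b \<Longrightarrow> b \<le> s \<Longrightarrow> x + a *\<^sub>R v + b *\<^sub>R w \<in> S"
  obtains a b where "0 < a" "a < s" "0 < b" "b < s"
    "f (x + s *\<^sub>R v + s *\<^sub>R w) - f (x + s *\<^sub>R v) - f (x + s *\<^sub>R w) + f x =
       s * s * dir_deriv w (dir_deriv v f) (x + a *\<^sub>R v + b *\<^sub>R w)"
proof -
  define g where "g a = f ((x + s *\<^sub>R w) + a *\<^sub>R v) - f (x + a *\<^sub>R v)" for a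
  have fd: "f differentiable at ((x + s *\<^sub>R w) + a *\<^sub>R v)" "f differentiable at (x + a *\<^sub>R v)"
    if "0 \<le> a" "a \<le> s" for a
    using smooth_on_imp_differentiable[OF f] sub[of a s] sub[of a 0] that s
    by (auto simp: algebra_simps)
  have "(g has_real_derivative
      dir_deriv v f ((x + s *\<^sub>R w) + a *\<^sub>R v) - dir_deriv v f (x + a *\<^sub>R v)) (at a)"
    if "0 \<le> a" "a \<le> s" for a
    unfolding g_def by (intro DERIV_diff has_real_derivative_along_line fd that)
  from MVT2[OF s this] obtain a where a: "0 < a" "a < s" and
    1: "g s - g 0 = (s - 0) * (dir_deriv v f ((x + s *\<^sub>R w) + a *\<^sub>R v) - dir_deriv v f (x + a *\<^sub>R v))"
    by metis
  have "((\<lambda>b. dir_deriv v f ((x + a *\<^sub>R v) + b *\<^sub>R w)) has_real_derivative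
      dir_deriv w (dir_deriv v f) ((x + a *\<^sub>R v) + b *\<^sub>R w)) (at b)" if "0 \<le> b" "b \<le> s" for b
    by (intro has_real_derivative_along_line smooth_on_imp_differentiable[OF smooth_on_dir_deriv[OF f]]
        sub) (use a that in auto)
  from MVT2[OF s this] obtain b where b: "0 < b" "b < s" and
    2: "dir_deriv v f ((x + a *\<^sub>R v) + s *\<^sub>R w) - dir_deriv v f ((x + a *\<^sub>R v) + 0 *\<^sub>R w) =
      (s - 0) * dir_deriv w (dir_deriv v f) ((x + a *\<^sub>R v) + b *\<^sub>R w)" by metis
  show ?thesis
    using 1 2 by (intro that[OF a b]) (simp add: g_def algebra_simps)
qed

lemma dir_deriv_commute:
  fixes f :: "'a::euclidean_space \<Rightarrow> real"
  assumes S: "open S" and f: "smooth_on f S" and x: "x \<in> S"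
  shows "dir_deriv v (dir_deriv w f) x = dir_deriv w (dir_deriv v f) x"
proof (rule ccontr)
  define P where "P = dir_deriv v (dir_deriv w f)"
  define Q where "Q = dir_deriv w (dir_deriv v f)"
  \<comment> \<open>Half the gap: two numbers within e of \<open>P x\<close> and \<open>Q x\<close>
    respectively cannot be equal.\<close>
  define e where "e = \<bar>P x - Q x\<bar> / 2"
  assume "dir_deriv v (dir_deriv w f) x \<noteq> dir_deriv w (dir_deriv v f) x"
  then have e: "e > 0" by (auto simp: P_def Q_def e_def)
  have "continuous_on S P" "continuous_on S Q"
    unfolding P_def Q_def by (intro smooth_on_imp_continuous_on smooth_on_dir_deriv f)+
  then have "isCont P x" "isCont Q x"
    using S x by (auto simp: continuous_on_eq_continuous_at)
  then have "(P \<longlongrightarrow> P x) (nhds x)" "(Q \<longlongrightarrow> Q x) (nhds x)"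
    by (simp_all add: isCont_def tendsto_at_iff_tendsto_nhds)
  then have "\<forall>\<^sub>F y in nhds x. y \<in> S \<and> dist (P y) (P x) < e \<and> dist (Q y) (Q x) < e"
    using e S x by (auto simp: eventually_conj_iff eventually_nhds_in_open dest: tendstoD)
  then obtain d where d: "d > 0" and
    D: "\<And>y. dist y x < d \<Longrightarrow> y \<in> S \<and> dist (P y) (P x) < e \<and> dist (Q y) (Q x) < e"
    unfolding eventually_nhds_metric by blast
  \<comment> \<open>Small enough to keep the whole parallelogram, in either order of the directions,
    within d of x; the summand 1 covers v = w = 0.\<close>
  define s where "s = d / (2 * (norm v + norm w + 1))"
  have s: "s > 0" using d by (simp add: s_def add_nonneg_pos)
  have near: "dist (x + a *\<^sub>R v + b *\<^sub>R w) x < d" "dist (x + a *\<^sub>R w + b *\<^sub>R v) x < d"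
    if "0 \<le> a" "a \<le> s" "0 \<le> b" "b \<le> s" for a b
  proof -
    have pos: "norm v + norm w + 1 > 0" by (simp add: add_nonneg_pos)
    have "norm (a *\<^sub>R p + b *\<^sub>R q) < d" if "norm p + norm q = norm v + norm w" for p q :: 'a
    proof -
      have "norm (a *\<^sub>R p + b *\<^sub>R q) \<le> s * norm p + s * norm q"
        using \<open>0 \<le> a\<close> \<open>a \<le> s\<close> \<open>0 \<le> b\<close> \<open>b \<le> s\<close>
        by (intro order.trans[OF norm_triangle_ineq] add_mono) (auto intro: mult_right_mono)
      also have "\<dots> \<le> s * (norm v + norm w + 1)"
        using that s by (simp add: distrib_left[symmetric])
      also have "\<dots> = d / 2"
      proof -
        have "d / (2 * c) * c = d / 2" if "c > 0" for c using that by simp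
        from this[OF pos] show ?thesis unfolding s_def .
      qed
      finally show ?thesis using d by simp
    qed
    from this[of v w] this[of w v] show "dist (x + a *\<^sub>R v + b *\<^sub>R w) x < d"
      "dist (x + a *\<^sub>R w + b *\<^sub>R v) x < d"
      by (auto simp: dist_norm algebra_simps)
  qed
  obtain a b where ab: "0 < a" "a < s" "0 < b" "b < s"
    "f (x + s *\<^sub>R v + s *\<^sub>R w) - f (x + s *\<^sub>R v) - f (x + s *\<^sub>R w) + f x =
       s * s * Q (x + a *\<^sub>R v + b *\<^sub>R w)"
    using second_difference_mean_value[OF S f s, of x v w] near D unfolding Q_def by metis
  obtain a' b' where ab': "0 < a'" "a' < s" "0 < b'" "b' < s"
    "f (x + s *\<^sub>R w + s *\<^sub>R v) - f (x + s *\<^sub>R w) - f (x + s *\<^sub>R v) + f x =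
       s * s * P (x + a' *\<^sub>R w + b' *\<^sub>R v)"
    using second_difference_mean_value[OF S f s, of x w v] near D unfolding P_def by metis
  have "s * s * Q (x + a *\<^sub>R v + b *\<^sub>R w) = s * s * P (x + a' *\<^sub>R w + b' *\<^sub>R v)"
    using ab(5) ab'(5) by (simp add: algebra_simps)
  then have "Q (x + a *\<^sub>R v + b *\<^sub>R w) = P (x + a' *\<^sub>R w + b' *\<^sub>R v)" using s by simp
  moreover have "dist (Q (x + a *\<^sub>R v + b *\<^sub>R w)) (Q x) < e" using D near(1)[of a b] ab by auto
  moreover have "dist (P (x + a' *\<^sub>R w + b' *\<^sub>R v)) (P x) < e" using D near(2)[of a' b'] ab' by auto
  ultimately show False unfolding dist_real_def e_def by argo
qed

section \<open>Power series in several variables\<close>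

lemma summable_on_real_comparison:
  fixes f g :: "'i \<Rightarrow> real"
  assumes g: "g summable_on I" and le: "\<And>i. i \<in> I \<Longrightarrow> \<bar>f i\<bar> \<le> g i"
  shows "f summable_on I"
proof -
  have "(\<lambda>i. norm (f i)) summable_on I"
    by (rule summable_on_comparison_test[OF g]) (use le in auto)
  then show ?thesis by (rule abs_summable_summable)
qed

lemma has_sum_diff_real:
  fixes f g :: "'i \<Rightarrow> real"
  assumes "(f has_sum a) I" "(g has_sum b) I"
  shows "((\<lambda>i. f i - g i) has_sum (a - b)) I"
  using has_sum_add[OF assms(1), of "\<lambda>i. - g i" "- b"] assms(2) by (simp add: has_sum_uminus)

text \<open>One summable family M bounds every derivative on S, so up to a small tail of M the
  series behaves like a finite sum.\<close>

lemma has_derivative_infsum: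
  fixes f :: "'i \<Rightarrow> 'a::real_normed_vector \<Rightarrow> real"
  assumes S: "convex S" "open S" and x: "x \<in> S"
    and D: "\<And>i y. i \<in> I \<Longrightarrow> y \<in> S \<Longrightarrow> (f i has_derivative f' i y) (at y)"
    and B: "\<And>i y h. i \<in> I \<Longrightarrow> y \<in> S \<Longrightarrow> \<bar>f' i y h\<bar> \<le> M i * norm h"
    and M: "M summable_on I" "\<And>i. i \<in> I \<Longrightarrow> M i \<ge> 0"
    and F: "\<And>y. y \<in> S \<Longrightarrow> (\<lambda>i. f i y) summable_on I"
  shows "((\<lambda>y. \<Sum>\<^sub>\<infinity>i\<in>I. f i y) has_derivative (\<lambda>h. \<Sum>\<^sub>\<infinity>i\<in>I. f' i x h)) (at x)"
  unfolding has_derivative_at_alt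
proof (intro conjI allI impI)
  have lin: "linear (f' i x)" if "i \<in> I" for i
    using D[OF that x] has_derivative_linear by blast
  have sum': "(\<lambda>i. f' i x h) summable_on I" for h
    by (rule summable_on_real_comparison[OF summable_on_cmult_left[OF M(1)] B[OF _ x]])
  show "bounded_linear (\<lambda>h. \<Sum>\<^sub>\<infinity>i\<in>I. f' i x h)"
  proof (rule bounded_linear_intro)
    fix h k :: 'a and r :: real
    have "(\<Sum>\<^sub>\<infinity>i\<in>I. f' i x (h + k)) = (\<Sum>\<^sub>\<infinity>i\<in>I. f' i x h + f' i x k)"
      by (intro infsum_cong) (simp add: linear_add lin)
    then show "(\<Sum>\<^sub>\<infinity>i\<in>I. f' i x (h + k)) = (\<Sum>\<^sub>\<infinity>i\<in>I. f' i x h) + (\<Sum>\<^sub>\<infinity>i\<in>I. f' i x k)"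
      by (simp add: infsum_add sum')
    have "(\<Sum>\<^sub>\<infinity>i\<in>I. f' i x (r *\<^sub>R h)) = (\<Sum>\<^sub>\<infinity>i\<in>I. r * f' i x h)"
      by (intro infsum_cong) (simp add: linear_cmul lin)
    then show "(\<Sum>\<^sub>\<infinity>i\<in>I. f' i x (r *\<^sub>R h)) = r *\<^sub>R (\<Sum>\<^sub>\<infinity>i\<in>I. f' i x h)"
      by (simp add: infsum_cmult_right')
    have "norm (\<Sum>\<^sub>\<infinity>i\<in>I. f' i x h) \<le> (\<Sum>\<^sub>\<infinity>i\<in>I. M i * norm h)"
      by (rule norm_infsum_le[where f="\<lambda>i. f' i x h"])
        (use B x sum' M in \<open>auto intro!: has_sum_infsum summable_on_cmult_left\<close>)
    then show "norm (\<Sum>\<^sub>\<infinity>i\<in>I. f' i x h) \<le> norm h * (\<Sum>\<^sub>\<infinity>i\<in>I. M i)"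
      by (simp add: infsum_cmult_left' mult.commute)
  qed
  fix e :: real assume e: "e > 0"
  \<comment> \<open>The tail of the remainders is at most 2 |y - x| times the tail of M, hence e/4
    here; it then costs e/2, as does the finite part.\<close>
  obtain J where J: "finite J" "J \<subseteq> I" "dist (sum M J) (infsum M I) \<le> e / 4"
    using infsum_finite_approximation[OF M(1), of "e / 4"] e by auto
  have MIJ: "infsum M (I - J) \<le> e / 4"
  proof -
    have "infsum M (I - J) = infsum M I - sum M J"
      using infsum_Diff[of M I J] J M by (simp add: summable_on_finite)
    then show ?thesis using J(3) unfolding dist_real_def by linarith
  qed
  have "((\<lambda>y. \<Sum>i\<in>J. f i y) has_derivative (\<lambda>h. \<Sum>i\<in>J. f' i x h)) (at x)"
    using J D x by (intro has_derivative_sum) auto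
  then obtain d1 where d1: "d1 > 0" "\<And>y. norm (y - x) < d1 \<Longrightarrow>
      norm ((\<Sum>i\<in>J. f i y) - (\<Sum>i\<in>J. f i x) - (\<Sum>i\<in>J. f' i x (y - x))) \<le> e / 2 * norm (y - x)"
    unfolding has_derivative_at_alt using e by (metis half_gt_zero)
  obtain d2 where d2: "d2 > 0" "ball x d2 \<subseteq> S"
    using S x openE by blast
  show "\<exists>d>0. \<forall>y. norm (y - x) < d \<longrightarrow> norm ((\<Sum>\<^sub>\<infinity>i\<in>I. f i y) - (\<Sum>\<^sub>\<infinity>i\<in>I. f i x) -
      (\<Sum>\<^sub>\<infinity>i\<in>I. f' i x (y - x))) \<le> e * norm (y - x)"
  proof (intro exI[of _ "min d1 d2"] conjI allI impI)
    show "0 < min d1 d2" using d1 d2 by simp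
    fix y assume y: "norm (y - x) < min d1 d2"
    then have yS: "y \<in> S" using d2 by (auto simp: subset_iff dist_norm norm_minus_commute)
    define r where "r i = f i y - f i x - f' i x (y - x)" for i
    have r_has_sum: "(r has_sum (\<Sum>\<^sub>\<infinity>i\<in>I. f i y) - (\<Sum>\<^sub>\<infinity>i\<in>I. f i x)
        - (\<Sum>\<^sub>\<infinity>i\<in>I. f' i x (y - x))) I"
      unfolding r_def by (intro has_sum_diff_real has_sum_infsum F yS x sum')
    then have r_sum: "r summable_on I" by (rule has_sum_imp_summable)
    \<comment> \<open>M i |y - x| bounds the increment, by the mean value theorem on the convex S,
      and it bounds the linear part directly; this is the factor 2.\<close>
    have r_le: "\<bar>r i\<bar> \<le> M i * (2 * norm (y - x))" if i: "i \<in> I" for i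
    proof -
      have "norm (f i y - f i x) \<le> M i * norm (y - x)"
      proof (rule differentiable_bound[OF S(1) _ _ yS x])
        show "(f i has_derivative f' i z) (at z within S)" if "z \<in> S" for z
          using D[OF i that] has_derivative_at_withinI by blast
        show "onorm (f' i z) \<le> M i" if "z \<in> S" for z
          by (rule onorm_bound) (use B[OF i that] M(2)[OF i] in auto)
      qed
      moreover have "\<bar>f' i x (y - x)\<bar> \<le> M i * norm (y - x)" using B[OF i x] .
      ultimately show ?thesis unfolding r_def real_norm_def by linarith
    qed
    have "\<bar>infsum r (I - J)\<bar> \<le> (\<Sum>\<^sub>\<infinity>i\<in>I - J. M i * (2 * norm (y - x)))"
      unfolding real_norm_def[symmetric]
      by (rule norm_infsum_le[where f=r])
        (use r_le r_sum M in \<open>auto intro!: has_sum_infsum summable_on_cmult_left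
          intro: summable_on_subset_banach\<close>)
    also have "\<dots> \<le> e / 4 * (2 * norm (y - x))"
      unfolding infsum_cmult_left' using MIJ by (intro mult_right_mono) auto
    finally have 1: "\<bar>infsum r (I - J)\<bar> \<le> e / 2 * norm (y - x)" by simp
    have 2: "infsum r (I - J) = infsum r I - sum r J"
      using infsum_Diff[of r I J] J r_sum by (simp add: summable_on_finite)
    have 3: "infsum r I = (\<Sum>\<^sub>\<infinity>i\<in>I. f i y) - (\<Sum>\<^sub>\<infinity>i\<in>I. f i x) - (\<Sum>\<^sub>\<infinity>i\<in>I. f' i x (y - x))"
      using r_has_sum by (rule infsumI)
    have 4: "\<bar>sum r J\<bar> \<le> e / 2 * norm (y - x)"
      using d1(2)[of y] y by (simp add: r_def sum_subtractf)
    show "norm ((\<Sum>\<^sub>\<infinity>i\<in>I. f i y) - (\<Sum>\<^sub>\<infinity>i\<in>I. f i x) - (\<Sum>\<^sub>\<infinity>i\<in>I. f' i x (y - x)))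
        \<le> e * norm (y - x)"
    proof -
      have "\<bar>b\<bar> \<le> E" if "\<bar>a\<bar> \<le> E / 2" "a = b - c" "\<bar>c\<bar> \<le> E / 2" for a b c E :: real
        using that by argo
      from this[of "infsum r (I - J)" "e * norm (y - x)" "infsum r I" "sum r J"] show ?thesis
        using 1 2 4 unfolding 3 by simp
    qed
  qed
qed

section \<open>Derivatives of power series\<close>

definition power_series :: "(('a::euclidean_space \<Rightarrow> nat) \<Rightarrow> real) \<Rightarrow> 'a \<Rightarrow> real" where
  "power_series c h = (\<Sum>\<^sub>\<infinity>\<alpha>\<in>Basis \<rightarrow>\<^sub>E UNIV. power_series_term c h \<alpha>)"

definition deriv_coeffs ::
    "'a::euclidean_space \<Rightarrow> (('a \<Rightarrow> nat) \<Rightarrow> real) \<Rightarrow> ('a \<Rightarrow> nat) \<Rightarrow> real" where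
  "deriv_coeffs b c \<alpha> = real (Suc (\<alpha> b)) * c (\<alpha>(b := Suc (\<alpha> b)))"

text \<open>The termwise partial derivative; unlike \<open>deriv_coeffs\<close>, it keeps the original multi-index.\<close>

definition partial_term ::
    "'a::euclidean_space \<Rightarrow> (('a \<Rightarrow> nat) \<Rightarrow> real) \<Rightarrow> 'a \<Rightarrow> ('a \<Rightarrow> nat) \<Rightarrow> real" where
  "partial_term b c h \<alpha> =
     c \<alpha> * (real (\<alpha> b) * (h \<bullet> b) ^ (\<alpha> b - 1) * (\<Prod>j\<in>Basis - {b}. (h \<bullet> j) ^ \<alpha> j))"

lemma has_derivative_power_series_term:
  "((\<lambda>h. power_series_term c h \<alpha>) has_derivative
     (\<lambda>v. \<Sum>b\<in>Basis. (v \<bullet> b) * partial_term b c h \<alpha>)) (at h)"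
proof -
  have "((\<lambda>h. \<Prod>b\<in>Basis. (h \<bullet> b) ^ \<alpha> b) has_derivative (\<lambda>v. \<Sum>b\<in>Basis.
      (real (\<alpha> b) * (v \<bullet> b) * (h \<bullet> b) ^ (\<alpha> b - 1)) * (\<Prod>j\<in>Basis - {b}. (h \<bullet> j) ^ \<alpha> j))) (at h)"
    by (intro has_derivative_prod) (auto intro!: derivative_eq_intros simp: ac_simps)
  from has_derivative_mult_right[OF this, of "c \<alpha>"] show ?thesis
    unfolding power_series_term_def partial_term_def
    by (rule has_derivative_eq_rhs) (simp add: sum_distrib_left ac_simps)
qed

text \<open>Shifting the multi-index by one in the coordinate b matches the two families. Indices
  with \<alpha> b = 0, where the truncated subtraction would break the bijection, carry the factor 0
  and drop out.\<close>

lemma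
  fixes b :: "'a::euclidean_space"
  assumes b: "b \<in> Basis"
  shows summable_on_partial_term_iff: "partial_term b c h summable_on (Basis \<rightarrow>\<^sub>E UNIV) \<longleftrightarrow>
      power_series_term (deriv_coeffs b c) h summable_on (Basis \<rightarrow>\<^sub>E UNIV)"
    and infsum_partial_term:
      "infsum (partial_term b c h) (Basis \<rightarrow>\<^sub>E UNIV) = power_series (deriv_coeffs b c) h"
proof -
  let ?I = "Basis \<rightarrow>\<^sub>E UNIV :: ('a \<Rightarrow> nat) set"
  let ?J = "{\<alpha>\<in>?I. \<alpha> b \<noteq> 0}"
  let ?up = "\<lambda>\<alpha>::'a \<Rightarrow> nat. \<alpha>(b := Suc (\<alpha> b))" and ?down = "\<lambda>\<alpha>::'a \<Rightarrow> nat. \<alpha>(b := \<alpha> b - 1)"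
  have eq: "power_series_term (deriv_coeffs b c) h (?down \<alpha>) = partial_term b c h \<alpha>" if "\<alpha> \<in> ?J" for \<alpha>
  proof -
    have up: "deriv_coeffs b c (?down \<alpha>) = real (\<alpha> b) * c \<alpha>"
      using that by (simp add: deriv_coeffs_def)
    have "(\<Prod>j\<in>Basis. (h \<bullet> j) ^ ?down \<alpha> j) =
        (h \<bullet> b) ^ (\<alpha> b - 1) * (\<Prod>j\<in>Basis - {b}. (h \<bullet> j) ^ ?down \<alpha> j)"
      using prod.remove[OF finite_Basis b, of "\<lambda>j. (h \<bullet> j) ^ ?down \<alpha> j"] by simp
    also have "(\<Prod>j\<in>Basis - {b}. (h \<bullet> j) ^ ?down \<alpha> j) = (\<Prod>j\<in>Basis - {b}. (h \<bullet> j) ^ \<alpha> j)"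
      by (intro prod.cong) auto
    finally show ?thesis
      unfolding power_series_term_def partial_term_def up by (simp only: ac_simps)
  qed
  have zero: "partial_term b c h \<alpha> = 0" if "\<alpha> \<in> ?I - ?J" for \<alpha>
    using that by (simp add: partial_term_def)
  have maps: "?up (?down \<alpha>) = \<alpha>" "?down \<alpha> \<in> ?I" if "\<alpha> \<in> ?J" for \<alpha>
    using that b by (auto simp: PiE_iff extensional_def)
  have maps': "?down (?up \<alpha>) = \<alpha>" "?up \<alpha> \<in> ?J" if "\<alpha> \<in> ?I" for \<alpha>
    using that b by (auto simp: PiE_iff extensional_def)
  have "partial_term b c h summable_on ?I \<longleftrightarrow> partial_term b c h summable_on ?J"
    by (rule summable_on_cong_neutral) (use zero in auto)
  also have "\<dots> \<longleftrightarrow> power_series_term (deriv_coeffs b c) h summable_on ?I"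
    by (rule summable_on_reindex_bij_witness[where i = ?up and j = ?down])
      (use maps maps' eq in auto)
  finally show "partial_term b c h summable_on ?I \<longleftrightarrow>
      power_series_term (deriv_coeffs b c) h summable_on ?I" .
  have "infsum (partial_term b c h) ?I = infsum (partial_term b c h) ?J"
    by (rule infsum_cong_neutral) (use zero in auto)
  also have "\<dots> = power_series (deriv_coeffs b c) h"
    unfolding power_series_def
    by (rule infsum_reindex_bij_witness[where i = ?up and j = ?down])
      (use maps maps' eq in auto)
  finally show "infsum (partial_term b c h) ?I = power_series (deriv_coeffs b c) h" .
qed

text \<open>A Bernoulli-type bound: it pays for the factor n produced by differentiation with an
  increase of the base by e.\<close>

lemma power_add_ge_linear:
  fixes y e :: real
  assumes "y \<ge> 0" "e \<ge> 0"
  shows "y ^ n + real n * y ^ (n - 1) * e \<le> (y + e) ^ n"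
proof (induction n)
  case (Suc n)
  have "y ^ Suc n + real (Suc n) * y ^ n * e \<le> (y ^ n + real n * y ^ (n - 1) * e) * (y + e)"
    using assms by (cases n) (auto simp: algebra_simps)
  also have "\<dots> \<le> (y + e) ^ n * (y + e)"
    using Suc assms by (intro mult_right_mono) auto
  finally show ?case by (simp add: mult.commute)
qed simp

text \<open>Plays the part of Cauchy's estimate: a differentiated term is controlled by the
  undifferentiated one at a point with coordinates larger by e, divided by e.\<close>

lemma abs_partial_term_le:
  fixes b :: "'a::euclidean_space"
  assumes b: "b \<in> Basis" and e: "e > 0" and x: "\<And>j. j \<in> Basis \<Longrightarrow> \<bar>x \<bullet> j\<bar> + e \<le> h \<bullet> j"
  shows "\<bar>partial_term b c x \<alpha>\<bar> \<le> \<bar>power_series_term c h \<alpha>\<bar> / e"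
proof -
  have "e * (real (\<alpha> b) * \<bar>x \<bullet> b\<bar> ^ (\<alpha> b - 1)) \<le> \<bar>x \<bullet> b\<bar> ^ \<alpha> b + real (\<alpha> b) * \<bar>x \<bullet> b\<bar> ^ (\<alpha> b - 1) * e"
    by (simp add: ac_simps)
  also have "\<dots> \<le> (\<bar>x \<bullet> b\<bar> + e) ^ \<alpha> b"
    using e by (intro power_add_ge_linear) auto
  also have "\<dots> \<le> (h \<bullet> b) ^ \<alpha> b"
    using e x[OF b] by (intro power_mono) auto
  finally have 1: "e * (real (\<alpha> b) * \<bar>x \<bullet> b\<bar> ^ (\<alpha> b - 1)) \<le> (h \<bullet> b) ^ \<alpha> b" .
  have xj: "\<bar>x \<bullet> j\<bar> \<le> h \<bullet> j" if "j \<in> Basis" for j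
    using x[OF that] e by linarith
  have 2: "(\<Prod>j\<in>Basis - {b}. \<bar>x \<bullet> j\<bar> ^ \<alpha> j) \<le> (\<Prod>j\<in>Basis - {b}. (h \<bullet> j) ^ \<alpha> j)"
    using xj by (intro prod_mono conjI power_mono) auto
  have nn: "0 \<le> h \<bullet> j" if "j \<in> Basis" for j using x[OF that] e by linarith
  have "e * \<bar>partial_term b c x \<alpha>\<bar> = \<bar>c \<alpha>\<bar> * ((e * (real (\<alpha> b) * \<bar>x \<bullet> b\<bar> ^ (\<alpha> b - 1))) *
      (\<Prod>j\<in>Basis - {b}. \<bar>x \<bullet> j\<bar> ^ \<alpha> j))"
    by (simp add: partial_term_def abs_mult power_abs abs_prod ac_simps)
  also have "\<dots> \<le> \<bar>c \<alpha>\<bar> * ((h \<bullet> b) ^ \<alpha> b * (\<Prod>j\<in>Basis - {b}. (h \<bullet> j) ^ \<alpha> j))"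
    using e by (intro mult_left_mono mult_mono 1 2) (auto intro!: prod_nonneg zero_le_power nn b)
  also have "\<dots> = \<bar>power_series_term c h \<alpha>\<bar>"
    using nn by (simp add: power_series_term_def abs_mult abs_prod prod.remove[OF finite_Basis b] b)
  finally show ?thesis using e by (simp add: field_simps)
qed

lemma has_sum_sum:
  fixes f :: "'j \<Rightarrow> 'i \<Rightarrow> real"
  assumes "\<And>j. j \<in> J \<Longrightarrow> (f j has_sum S j) I"
  shows "((\<lambda>i. \<Sum>j\<in>J. f j i) has_sum (\<Sum>j\<in>J. S j)) I"
  using assms by (induction J rule: infinite_finite_induct) (auto intro: has_sum_add)

lemma
  fixes c :: "('a::euclidean_space \<Rightarrow> nat) \<Rightarrow> real"
  assumes conv: "\<And>h. norm h < r \<Longrightarrow> power_series_term c h summable_on (Basis \<rightarrow>\<^sub>E UNIV)"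
    and h: "norm h < r"
  shows summable_on_deriv_coeffs: "b \<in> Basis \<Longrightarrow>
      power_series_term (deriv_coeffs b c) h summable_on (Basis \<rightarrow>\<^sub>E UNIV)"
    and has_derivative_power_series: "(power_series c has_derivative
      (\<lambda>v. \<Sum>b\<in>Basis. (v \<bullet> b) * power_series (deriv_coeffs b c) h)) (at h)"
proof -
  let ?I = "Basis \<rightarrow>\<^sub>E UNIV :: ('a \<Rightarrow> nat) set"
  \<comment> \<open>Chosen so that adding 2e to each coordinate raises the norm by at most 2e times
    the dimension, which is half of \<open>r - norm h\<close>.\<close>
  define e where "e = (r - norm h) / (4 * DIM('a))"
  have e: "e > 0" using h by (simp add: e_def)
  define k where "k = (\<Sum>j\<in>Basis. (\<bar>h \<bullet> j\<bar> + 2 * e) *\<^sub>R j)"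
  have kj: "k \<bullet> j = \<bar>h \<bullet> j\<bar> + 2 * e" if "j \<in> Basis" for j
    using that by (simp add: k_def)
  have "k = (\<Sum>j\<in>Basis. \<bar>h \<bullet> j\<bar> *\<^sub>R j) + (\<Sum>j\<in>Basis. (2 * e) *\<^sub>R j)"
    by (simp add: k_def scaleR_add_left sum.distrib)
  then have "norm k \<le> norm (\<Sum>j\<in>Basis. \<bar>h \<bullet> j\<bar> *\<^sub>R j) + norm (\<Sum>j\<in>(Basis::'a set). (2 * e) *\<^sub>R j)"
    using norm_triangle_ineq by metis
  also have "\<dots> \<le> norm h + (\<Sum>j\<in>(Basis::'a set). norm ((2 * e) *\<^sub>R j))"
    by (intro add_mono norm_sum norm_le_componentwise) simp
  also have "\<dots> = norm h + (r - norm h) / 2"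
    using h by (simp add: e_def)
  also have "\<dots> < r" using h by (simp add: field_simps)
  finally have k: "norm k < r" .
  \<comment> \<open>k exceeds |h| by 2e in each coordinate: one e is room for y to vary in this box,
    the other feeds \<open>abs_partial_term_le\<close>.\<close>
  define S where "S = box (\<Sum>j\<in>Basis. - (\<bar>h \<bullet> j\<bar> + e) *\<^sub>R j) (\<Sum>j\<in>Basis. (\<bar>h \<bullet> j\<bar> + e) *\<^sub>R j)"
  have S_iff: "y \<in> S \<longleftrightarrow> (\<forall>j\<in>Basis. \<bar>y \<bullet> j\<bar> < \<bar>h \<bullet> j\<bar> + e)" for y
    by (auto simp: S_def mem_box abs_less_iff)
  have hS: "h \<in> S" using e by (simp add: S_iff)
  have S_k: "\<bar>y \<bullet> j\<bar> + e \<le> k \<bullet> j" if "y \<in> S" "j \<in> Basis" for y j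
    using that kj[of j] unfolding S_iff by force
  have S_r: "norm y < r" if "y \<in> S" for y
  proof -
    have "norm y \<le> norm k"
      using S_k[OF that] e by (intro norm_le_componentwise) (smt (verit))
    then show ?thesis using k by simp
  qed
  have abs_k: "(\<lambda>\<alpha>. \<bar>power_series_term c k \<alpha>\<bar>) summable_on ?I"
    using conv[OF k] summable_on_iff_abs_summable_on_real by force
  have partial_le: "\<bar>partial_term b c y \<alpha>\<bar> \<le> \<bar>power_series_term c k \<alpha>\<bar> * (1 / e)"
    if "b \<in> Basis" "y \<in> S" for b y \<alpha>
    using abs_partial_term_le[OF that(1) e S_k[OF that(2)]] by simp
  have sum_partial: "partial_term b c h summable_on ?I" if "b \<in> Basis" for b
    by (rule summable_on_real_comparison[OF summable_on_cmult_left[OF abs_k] partial_le[OF that hS]])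
  then show "power_series_term (deriv_coeffs b c) h summable_on ?I" if "b \<in> Basis"
    using that summable_on_partial_term_iff by blast
  have "((\<lambda>y. \<Sum>\<^sub>\<infinity>\<alpha>\<in>?I. power_series_term c y \<alpha>) has_derivative
      (\<lambda>v. \<Sum>\<^sub>\<infinity>\<alpha>\<in>?I. \<Sum>b\<in>Basis. (v \<bullet> b) * partial_term b c h \<alpha>)) (at h)"
  proof (rule has_derivative_infsum[OF _ _ hS has_derivative_power_series_term])
    show "convex S" "open S" by (auto simp: S_def)
    show "(\<lambda>\<alpha>. \<bar>power_series_term c k \<alpha>\<bar> * (real DIM('a) / e)) summable_on ?I"
      by (rule summable_on_cmult_left[OF abs_k])
    show "0 \<le> \<bar>power_series_term c k \<alpha>\<bar> * (real DIM('a) / e)" for \<alpha>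
      using e by simp
    show "power_series_term c y summable_on ?I" if "y \<in> S" for y
      using conv S_r that by blast
    show "\<bar>\<Sum>b\<in>Basis. (v \<bullet> b) * partial_term b c y \<alpha>\<bar>
        \<le> \<bar>power_series_term c k \<alpha>\<bar> * (real DIM('a) / e) * norm v" if "y \<in> S" for y v \<alpha>
    proof -
      have "\<bar>\<Sum>b\<in>Basis. (v \<bullet> b) * partial_term b c y \<alpha>\<bar> \<le>
          (\<Sum>b\<in>(Basis::'a set). norm v * (\<bar>power_series_term c k \<alpha>\<bar> * (1 / e)))"
      proof (rule order.trans[OF sum_abs], rule sum_mono)
        fix b :: 'a assume b: "b \<in> Basis"
        show "\<bar>(v \<bullet> b) * partial_term b c y \<alpha>\<bar> \<le> norm v * (\<bar>power_series_term c k \<alpha>\<bar> * (1 / e))"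
          unfolding abs_mult by (intro mult_mono Basis_le_norm partial_le b that) auto
      qed
      also have "\<dots> = \<bar>power_series_term c k \<alpha>\<bar> * (real DIM('a) / e) * norm v"
        by (simp add: field_simps)
      finally show ?thesis .
    qed
  qed
  moreover have "(\<Sum>\<^sub>\<infinity>\<alpha>\<in>?I. \<Sum>b\<in>Basis. (v \<bullet> b) * partial_term b c h \<alpha>) =
      (\<Sum>b\<in>Basis. (v \<bullet> b) * power_series (deriv_coeffs b c) h)" for v
  proof (rule infsumI, rule has_sum_sum)
    fix b :: 'a assume b: "b \<in> Basis"
    have "(partial_term b c h has_sum power_series (deriv_coeffs b c) h) ?I"
      using sum_partial[OF b] infsum_partial_term[OF b] by (metis has_sum_infsum)
    then show "((\<lambda>\<alpha>. (v \<bullet> b) * partial_term b c h \<alpha>) has_sum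
        (v \<bullet> b) * power_series (deriv_coeffs b c) h) ?I"
      by (rule has_sum_cmult_right)
  qed
  ultimately show "(power_series c has_derivative
      (\<lambda>v. \<Sum>b\<in>Basis. (v \<bullet> b) * power_series (deriv_coeffs b c) h)) (at h)"
    unfolding power_series_def[abs_def] by simp
qed

lemma times_differentiable_on_power_series:
  fixes c :: "('a::euclidean_space \<Rightarrow> nat) \<Rightarrow> real"
  assumes "\<And>h. norm h < r \<Longrightarrow> power_series_term c h summable_on (Basis \<rightarrow>\<^sub>E UNIV)"
  shows "times_differentiable_on n (\<lambda>y. power_series c (y - x)) (ball x r)"
  using assms
proof (induction n arbitrary: c)
  case (Suc n)
  have D: "((\<lambda>y. power_series c (y - x)) has_derivative
      (\<lambda>v. \<Sum>b\<in>Basis. (v \<bullet> b) * power_series (deriv_coeffs b c) (y - x))) (at y)"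
    if "y \<in> ball x r" for y
  proof (rule has_derivative_compose[of "\<lambda>y. y - x" "\<lambda>v. v"])
    show "((\<lambda>y. y - x) has_derivative (\<lambda>v. v)) (at y)"
      by (auto intro!: derivative_eq_intros)
    show "(power_series c has_derivative
        (\<lambda>v. \<Sum>b\<in>Basis. (v \<bullet> b) * power_series (deriv_coeffs b c) (y - x))) (at (y - x))"
      using Suc.prems that by (intro has_derivative_power_series)
        (auto simp: dist_norm norm_minus_commute)
  qed
  have d: "(\<Sum>b\<in>Basis. (v \<bullet> b) * power_series (deriv_coeffs b c) (y - x)) =
      dir_deriv v (\<lambda>y. power_series c (y - x)) y" if "y \<in> ball x r" for y v
    using dir_deriv_eqI[OF D[OF that]] by simp
  have "times_differentiable_on n (dir_deriv v (\<lambda>y. power_series c (y - x))) (ball x r)" for v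
  proof (rule times_differentiable_on_cong[OF open_ball d], assumption)
    show "times_differentiable_on n
        (\<lambda>y. \<Sum>b\<in>Basis. (v \<bullet> b) * power_series (deriv_coeffs b c) (y - x)) (ball x r)"
      using Suc.prems
      by (intro times_differentiable_on_sum times_differentiable_on_mult
          times_differentiable_on_const Suc.IH summable_on_deriv_coeffs) auto
  qed
  then show ?case using differentiableI[OF D] by simp
qed simp

text \<open>S may be thin, like the sphere, and then f is uncontrolled off S. The series itself is
  the extension g: it is required to converge on the whole ball, also at points outside S.\<close>

lemma real_analytic_on_local_smooth:
  fixes f :: "'a::euclidean_space \<Rightarrow> real"
  assumes f: "real_analytic_on f S" and x: "x \<in> S"
  obtains g r where "r > 0" "smooth_on g (ball x r)" "\<And>y. y \<in> ball x r \<Longrightarrow> y \<in> S \<Longrightarrow> f y = g y"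
proof -
  obtain c r where r: "r > 0" and
    conv: "\<And>y. y \<in> ball x r \<Longrightarrow> power_series_term c (y - x) summable_on (Basis \<rightarrow>\<^sub>E UNIV)" and
    sum: "\<And>y. y \<in> ball x r \<Longrightarrow> y \<in> S \<Longrightarrow>
      (power_series_term c (y - x) has_sum f y) (Basis \<rightarrow>\<^sub>E UNIV)"
    using f x unfolding real_analytic_on_def by metis
  have conv': "power_series_term c h summable_on (Basis \<rightarrow>\<^sub>E UNIV)" if "norm h < r" for h
    using conv[of "x + h"] that by (simp add: dist_norm)
  have "smooth_on (\<lambda>y. power_series c (y - x)) (ball x r)"
    unfolding smooth_on_def using times_differentiable_on_power_series[OF conv'] by blast
  then show ?thesis
    by (rule that[OF r]) (use sum in \<open>auto simp: power_series_def intro!: infsumI[symmetric]\<close>)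
qed

lemma real_analytic_on_UNIV_imp_smooth_on:
  fixes f :: "'a::euclidean_space \<Rightarrow> real"
  assumes "real_analytic_on f UNIV"
  shows "smooth_on f UNIV"
  unfolding smooth_on_pointwise[of f UNIV]
proof
  fix x :: 'a
  obtain g r where g: "r > 0" "smooth_on g (ball x r)" "\<And>y. y \<in> ball x r \<Longrightarrow> f y = g y"
    using real_analytic_on_local_smooth[OF assms] by (metis UNIV_I)
  have "smooth_on f (ball x r)"
    by (rule smooth_on_cong[OF open_ball _ g(2)]) (use g in auto)
  then show "smooth_on f {x}" using g(1) by (auto elim: smooth_on_subset)
qed

section \<open>Analytic functions along curves\<close>

text \<open>The power series is complexified by substituting the entire extensions of the
  coordinates of the curve for its real variables. This makes the identity theorem for holomorphic
  functions of one variable available along the curve.\<close>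

lemma real_analytic_on_compose_entire:
  fixes f :: "'a::euclidean_space \<Rightarrow> real" and \<gamma> :: "real \<Rightarrow> 'a" and \<Gamma> :: "'a \<Rightarrow> complex \<Rightarrow> complex"
  assumes f: "real_analytic_on f S" and \<gamma>: "\<And>t. \<gamma> t \<in> S"
    and \<Gamma>: "\<And>b. b \<in> Basis \<Longrightarrow> \<Gamma> b holomorphic_on UNIV"
    and ext: "\<And>b t. b \<in> Basis \<Longrightarrow> \<Gamma> b (of_real t) = of_real (\<gamma> t \<bullet> b)"
  obtains g e where "e > 0" "g holomorphic_on ball (of_real t0) e"
    "\<And>t. \<bar>t - t0\<bar> < e \<Longrightarrow> g (of_real t) = of_real (f (\<gamma> t))"
proof -
  let ?I = "Basis \<rightarrow>\<^sub>E UNIV :: ('a \<Rightarrow> nat) set"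
  define x where "x = \<gamma> t0"
  obtain c r where r: "r > 0" and
    conv: "\<And>y. y \<in> ball x r \<Longrightarrow> power_series_term c (y - x) summable_on ?I" and
    sum: "\<And>y. y \<in> ball x r \<Longrightarrow> y \<in> S \<Longrightarrow> (power_series_term c (y - x) has_sum f y) ?I"
    using f \<gamma>[of t0] unfolding real_analytic_on_def x_def by metis
  \<comment> \<open>Makes the cube of half-side a fit into the ball: on it the norm is at most the
    sum of the absolute coordinates, hence at most r/2.\<close>
  define a where "a = r / (2 * DIM('a))"
  have a: "a > 0" using r by (simp add: a_def)
  have small: "norm k < r" if "\<And>j. j \<in> Basis \<Longrightarrow> \<bar>k \<bullet> j\<bar> \<le> a" for k :: 'a
  proof -
    have "norm k \<le> (\<Sum>j\<in>Basis. \<bar>k \<bullet> j\<bar>)" by (rule norm_le_l1)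
    also have "\<dots> \<le> (\<Sum>j\<in>(Basis::'a set). a)" using that by (intro sum_mono)
    also have "\<dots> = r / 2" by (simp add: a_def)
    finally show ?thesis using r by simp
  qed
  define k :: 'a where "k = (\<Sum>j\<in>Basis. a *\<^sub>R j)"
  have kj: "k \<bullet> j = a" if "j \<in> Basis" for j using that by (simp add: k_def)
  \<comment> \<open>Convergence at the corner of the cube, in general a point off S, dominates all
    complexified terms whose increments have modulus at most a.\<close>
  have "power_series_term c k summable_on ?I"
    using conv[of "x + k"] small[of k] a by (simp add: kj dist_norm)
  then have abs_k: "(\<lambda>\<alpha>. \<bar>power_series_term c k \<alpha>\<bar>) summable_on ?I"
    using summable_on_iff_abs_summable_on_real by force
  define z0 where "z0 = complex_of_real t0"
  have "\<exists>d>0. \<forall>z\<in>cball z0 d. norm (\<Gamma> b z - \<Gamma> b z0) \<le> a" if "b \<in> Basis" for b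
  proof -
    have "isCont (\<Gamma> b) z0"
      using holomorphic_on_imp_continuous_on[OF \<Gamma>[OF that]] by (simp add: continuous_on_eq_continuous_at)
    then obtain d where d: "d > 0" "\<And>z. dist z z0 < d \<Longrightarrow> dist (\<Gamma> b z) (\<Gamma> b z0) < a"
      using a unfolding continuous_at_eps_delta by metis
    then have "\<forall>z\<in>cball z0 (d / 2). norm (\<Gamma> b z - \<Gamma> b z0) \<le> a"
      by (force simp: dist_commute dist_norm[symmetric] intro: less_imp_le)
    then show ?thesis using d(1) by (metis half_gt_zero)
  qed
  then obtain d where d: "\<And>b. b \<in> Basis \<Longrightarrow> d b > 0"
    "\<And>b z. b \<in> Basis \<Longrightarrow> z \<in> cball z0 (d b) \<Longrightarrow> norm (\<Gamma> b z - \<Gamma> b z0) \<le> a" by metis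
  define e where "e = Min (d ` Basis)"
  have e: "e > 0" unfolding e_def using d(1) by (subst Min_gr_iff) auto
  have near: "norm (\<Gamma> b z - \<Gamma> b z0) \<le> a" if "b \<in> Basis" "z \<in> cball z0 e" for b z
  proof -
    have "e \<le> d b" unfolding e_def using that(1) by (intro Min_le) auto
    then show ?thesis using that d(2)[OF that(1), of z] by auto
  qed
  define T where "T \<alpha> z = of_real (c \<alpha>) * (\<Prod>b\<in>Basis. (\<Gamma> b z - \<Gamma> b z0) ^ \<alpha> b)" for \<alpha> z
  have T_le: "norm (T \<alpha> z) \<le> \<bar>power_series_term c k \<alpha>\<bar>" if "z \<in> cball z0 e" for \<alpha> z
  proof -
    have "norm (T \<alpha> z) = \<bar>c \<alpha>\<bar> * (\<Prod>b\<in>Basis. norm (\<Gamma> b z - \<Gamma> b z0) ^ \<alpha> b)"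
      by (simp add: T_def norm_mult norm_power flip: prod_norm)
    also have "\<dots> \<le> \<bar>c \<alpha>\<bar> * (\<Prod>b\<in>(Basis::'a set). a ^ \<alpha> b)"
      using near that by (intro mult_left_mono prod_mono conjI power_mono) auto
    also have "\<dots> = \<bar>power_series_term c k \<alpha>\<bar>"
      using a by (simp add: power_series_term_def abs_mult abs_prod power_abs kj)
    finally show ?thesis .
  qed
  define g where "g z = (\<Sum>\<^sub>\<infinity>\<alpha>\<in>?I. T \<alpha> z)" for z
  have unif: "uniform_limit (cball z0 e) (\<lambda>X z. \<Sum>\<alpha>\<in>X. T \<alpha> z) g (finite_subsets_at_top ?I)"
    unfolding g_def by (rule Weierstrass_m_test_general[OF T_le abs_k])
  have T_hol: "(\<lambda>z. \<Sum>\<alpha>\<in>X. T \<alpha> z) holomorphic_on A" for X A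
    unfolding T_def by (intro holomorphic_intros) (auto intro: holomorphic_on_subset[OF \<Gamma>])
  have "g holomorphic_on ball z0 e"
    by (rule holomorphic_uniform_limit[OF always_eventually unif])
      (auto intro: T_hol holomorphic_on_imp_continuous_on)
  moreover have "g (of_real t) = of_real (f (\<gamma> t))" if t: "\<bar>t - t0\<bar> < e" for t
  proof -
    have z: "of_real t \<in> cball z0 e"
      using t by (simp add: z0_def dist_norm norm_minus_commute flip: of_real_diff)
    have diff: "\<Gamma> b (of_real t) - \<Gamma> b z0 = of_real ((\<gamma> t - x) \<bullet> b)" if "b \<in> Basis" for b
      using ext[OF that] by (simp add: z0_def x_def inner_diff_left)
    have "norm (\<gamma> t - x) < r"
      using near[OF _ z] by (intro small) (simp only: diff norm_of_real)
    then have "(power_series_term c (\<gamma> t - x) has_sum f (\<gamma> t)) ?I"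
      using \<gamma> by (intro sum) (auto simp: dist_norm norm_minus_commute)
    then have "((\<lambda>\<alpha>. of_real (power_series_term c (\<gamma> t - x) \<alpha>)) has_sum complex_of_real (f (\<gamma> t))) ?I"
      by (simp add: has_sum_of_real_iff)
    also have "(\<lambda>\<alpha>. of_real (power_series_term c (\<gamma> t - x) \<alpha>)) = (\<lambda>\<alpha>. T \<alpha> (of_real t))"
      by (simp add: fun_eq_iff T_def power_series_term_def diff)
    finally show ?thesis unfolding g_def by (rule infsumI)
  qed
  ultimately show ?thesis using that e unfolding z0_def by blast
qed

text \<open>Otherwise g has a zero of finite order n at 0 and g = z^n h with h 0 \<noteq> 0, whereas
  flatness along the positive real axis makes g / z^n tend to 0 there.\<close>

lemma flat_holomorphic_eq_0:
  assumes e: "e > 0" and hol: "g holomorphic_on ball 0 e"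
    and flat: "\<And>n. \<exists>K d. d > 0 \<and> (\<forall>t\<in>{0<..<d}. norm (g (of_real t)) \<le> K * t ^ n)"
    and z: "z \<in> ball 0 e"
  shows "g z = 0"
proof -
  have cont: "isCont g 0"
    using holomorphic_on_imp_continuous_on[OF hol] e by (simp add: continuous_on_eq_continuous_at)
  have lim: "((\<lambda>t. g (of_real t)) \<longlongrightarrow> g 0) (at_right 0)" if "isCont g 0" for g :: "complex \<Rightarrow> complex"
    using that by (intro isCont_tendsto_compose[where g=g]) (auto intro!: tendsto_eq_intros)
  have flat': "((\<lambda>t. g (of_real t) / of_real t ^ n) \<longlongrightarrow> 0) (at_right 0)" for n
  proof -
    \<comment> \<open>One exponent more than n leaves a factor t that tends to 0.\<close>
    obtain K d where d: "d > 0" "\<forall>t\<in>{0<..<d}. norm (g (of_real t)) \<le> K * t ^ Suc n"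
      using flat[of "Suc n"] by blast
    have "\<forall>\<^sub>F t in at_right 0. norm (g (of_real t) / of_real t ^ n) \<le> K * t"
      using eventually_at_right_less eventually_at_right_real[OF d(1)]
    proof eventually_elim
      case (elim t)
      then have "norm (g (of_real t)) \<le> K * t * t ^ n" using d(2) by (auto simp: mult.assoc)
      then show ?case using elim by (simp add: norm_divide norm_power divide_le_eq)
    qed
    then show ?thesis
      by (rule Lim_null_comparison) (auto intro!: tendsto_eq_intros)
  qed
  have g0: "g 0 = 0"
    using tendsto_unique[OF _ lim[OF cont]] flat'[of 0] by simp
  show ?thesis
  proof (rule ccontr)
    assume "g z \<noteq> 0"
    then have nonconst: "\<not> g constant_on ball 0 e"
      using g0 z e unfolding constant_on_def by (metis centre_in_ball)
    have mem: "0 \<in> ball (0 :: complex) e" using e by simp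
    show False
    proof (rule holomorphic_factor_zero_nonconstant[OF hol open_ball connected_ball mem g0 nonconst])
      fix h r and n :: nat
      assume r: "0 < n" "0 < r" "ball 0 r \<subseteq> ball 0 e" "h holomorphic_on ball 0 r"
        "\<And>w. w \<in> ball 0 r \<Longrightarrow> g w = (w - 0) ^ n * h w" "\<And>w. w \<in> ball 0 r \<Longrightarrow> h w \<noteq> 0"
      have "isCont h 0"
        using holomorphic_on_imp_continuous_on[OF r(4)] r(2) by (simp add: continuous_on_eq_continuous_at)
      note lim[OF this]
      moreover have "((\<lambda>t. h (of_real t)) \<longlongrightarrow> 0) (at_right 0)"
      proof (rule Lim_transform_eventually[OF flat'[of n]])
        show "\<forall>\<^sub>F t in at_right 0. g (of_real t) / of_real t ^ n = h (of_real t)"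
          using eventually_at_right_less eventually_at_right_real[OF r(2)]
          by eventually_elim (use r(5) in auto)
      qed
      ultimately have "h 0 = 0"
        by (rule tendsto_unique[OF trivial_limit_at_right_real])
      then show False using r(6)[of 0] r(2) by simp
    qed
  qed
qed

text \<open>The extensions g are only local, so the connectedness argument runs on the real line:
  the set of points near which Q vanishes is open, is closed by the identity theorem, and contains 0
  by flatness.\<close>

lemma flat_locally_holomorphic_eq_0:
  fixes Q :: "real \<Rightarrow> real"
  assumes ext: "\<And>t0. \<exists>g e. e > 0 \<and> g holomorphic_on ball (of_real t0) e \<and>
      (\<forall>t. \<bar>t - t0\<bar> < e \<longrightarrow> g (of_real t) = complex_of_real (Q t))"
    and flat: "\<And>n. \<exists>K d. d > 0 \<and> (\<forall>t\<in>{0<..<d}. \<bar>Q t\<bar> \<le> K * t ^ n)"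
  shows "Q t = 0"
proof -
  define Z where "Z = {t. \<forall>\<^sub>F s in nhds t. Q s = 0}"
  have "open Z"
    unfolding open_subopen[of Z] by (auto simp: Z_def eventually_nhds)
  have zero_near: "\<forall>\<^sub>F s in nhds t0. Q s = 0"
    if "e > 0" "\<And>z. z \<in> ball (of_real t0) e \<Longrightarrow> g z = 0"
      "\<And>t. \<bar>t - t0\<bar> < e \<Longrightarrow> g (of_real t) = complex_of_real (Q t)" for g :: "complex \<Rightarrow> complex" and e t0
    unfolding eventually_nhds_metric
  proof (intro exI[of _ e] conjI allI impI \<open>e > 0\<close>)
    fix s assume s: "dist s t0 < e"
    then have "complex_of_real s \<in> ball (of_real t0) e"
      by (simp add: dist_norm norm_minus_commute flip: of_real_diff)
    then have "g (of_real s) = 0" by (rule that(2))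
    moreover have "g (of_real s) = complex_of_real (Q s)"
      using s by (intro that(3)) (simp add: dist_real_def)
    ultimately show "Q s = 0" by simp
  qed
  have "t0 \<in> Z" if t0: "t0 \<in> closure Z" for t0
  proof -
    obtain g e where g: "e > 0" "g holomorphic_on ball (of_real t0) e"
      "\<And>t. \<bar>t - t0\<bar> < e \<Longrightarrow> g (of_real t) = complex_of_real (Q t)"
      using ext[of t0] by auto
    obtain t where t: "t \<in> Z" "dist t t0 < e"
      using t0 g(1) unfolding closure_approachable by blast
    have "\<forall>\<^sub>F s in nhds t. Q s = 0 \<and> dist s t0 < e"
      using t unfolding Z_def
      by (auto simp: eventually_conj_iff intro!: eventually_nhds_in_open[of "ball t0 e", simplified dist_commute mem_ball]
            simp: dist_commute)
    then obtain d where d: "d > 0" "\<And>s. dist s t < d \<Longrightarrow> Q s = 0 \<and> dist s t0 < e"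
      unfolding eventually_nhds_metric by auto
    have cball: "complex_of_real s \<in> ball (of_real t0) e" if "dist s t0 < e" for s
      using that by (simp add: dist_norm norm_minus_commute flip: of_real_diff)
    have "g z = 0" if "z \<in> ball (of_real t0) e" for z
    \<comment> \<open>A point t of Z in the disc around t0 has a real interval about it on which g
      vanishes, and t is an accumulation point of that interval.\<close>
    proof (rule analytic_continuation[OF g(2) open_ball connected_ball])
      show "complex_of_real ` ball t d \<subseteq> ball (of_real t0) e"
        using d(2) cball by (auto simp: dist_commute)
      show "complex_of_real t \<in> ball (of_real t0) e" using cball t(2) by simp
      show "complex_of_real t islimpt complex_of_real ` ball t d"
        unfolding islimpt_approachable
      proof (intro allI impI)
        fix e' :: real assume "e' > 0"
        then have "t + min e' d / 2 \<in> ball t d" "t + min e' d / 2 \<noteq> t"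
          "dist (t + min e' d / 2) t < e'"
          using d(1) by (auto simp: dist_real_def min_def)
        then show "\<exists>x'\<in>complex_of_real ` ball t d. x' \<noteq> of_real t \<and> dist x' (of_real t) < e'"
          by (intro bexI[of _ "of_real (t + min e' d / 2)"] conjI imageI)
            (simp_all only: of_real_eq_iff dist_norm of_real_diff[symmetric] norm_of_real real_norm_def not_False_eq_True simp_thms)
      qed
      show "g z = 0" if "z \<in> complex_of_real ` ball t d" for z
        using that d(2) g(3) by (auto simp: dist_commute dist_real_def)
      show "z \<in> ball (of_real t0) e" by fact
    qed
    from zero_near[OF g(1) this g(3)] show ?thesis by (simp add: Z_def)
  qed
  then have "closure Z \<subseteq> Z" by (rule subsetI)
  then have "closed Z" using closure_subset_eq by blast
  have "0 \<in> Z"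
  proof -
    obtain g e where g: "e > 0" "g holomorphic_on ball (of_real 0) e"
      "\<And>t. \<bar>t - 0\<bar> < e \<Longrightarrow> g (of_real t) = complex_of_real (Q t)"
      using ext[of 0] by auto
    have "g z = 0" if "z \<in> ball 0 e" for z
    proof (rule flat_holomorphic_eq_0[OF g(1) _ _ that])
      show "g holomorphic_on ball 0 e" using g(2) by simp
      fix n
      obtain K d where d: "d > 0" "\<forall>t\<in>{0<..<d}. \<bar>Q t\<bar> \<le> K * t ^ n" using flat by blast
      show "\<exists>K d. d > 0 \<and> (\<forall>t\<in>{0<..<d}. norm (g (of_real t)) \<le> K * t ^ n)"
        using d g(1,3) by (intro exI[of _ K] exI[of _ "min d e"]) auto
    qed
    from zero_near[of e 0 g, OF g(1)] this g(3) show ?thesis by (auto simp: Z_def)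
  qed
  then have "Z = UNIV" using \<open>open Z\<close> \<open>closed Z\<close> clopen[of Z] by blast
  then show ?thesis by (auto simp: Z_def dest: eventually_nhds_x_imp_x)
qed

section \<open>Uniqueness for the Cauchy problem\<close>

text \<open>Taylor expansion in h: the even orders cancel in the difference, the odd orders below k
  vanish by assumption, and order k counts twice.\<close>

lemma odd_difference_limit:
  fixes g :: "'a::real_normed_vector \<Rightarrow> real"
  assumes S: "open S" and g: "smooth_on g S" and p: "p \<in> S" and k: "odd k"
    and zero: "\<And>m. odd m \<Longrightarrow> m < k \<Longrightarrow> (dir_deriv n ^^ m) g p = 0"
  shows "((\<lambda>h. (g (p + h *\<^sub>R n) - g (p - h *\<^sub>R n)) / h ^ k) \<longlongrightarrow>
      2 * (dir_deriv n ^^ k) g p / fact k) (at_right 0)"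
proof -
  \<comment> \<open>The m-th derivative of s \<mapsto> g(p + s n) - g(p - s n); the sign is the
    inner derivative of -s, once per differentiation.\<close>
  define D where "D m s = (dir_deriv n ^^ m) g (p + s *\<^sub>R n) -
    (-1) ^ m * (dir_deriv n ^^ m) g (p + (- s) *\<^sub>R n)" for m s
  have "((\<lambda>s. p + s *\<^sub>R n) \<longlongrightarrow> p) (nhds 0)"
    by (auto intro!: tendsto_eq_intros filterlim_ident)
  then have "\<forall>\<^sub>F s in nhds 0. p + s *\<^sub>R n \<in> S"
    using S p by (simp add: topological_tendstoD)
  then obtain h0 where h0: "h0 > 0" and inS: "\<And>s. \<bar>s\<bar> < h0 \<Longrightarrow> p + s *\<^sub>R n \<in> S"
    unfolding eventually_nhds_metric by (auto simp: dist_real_def)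
  have D_deriv: "(D m has_real_derivative D (Suc m) s) (at s)" if "\<bar>s\<bar> < h0" for m s
  proof -
    have diff: "(dir_deriv n ^^ m) g differentiable at (p + s *\<^sub>R n)" if "\<bar>s\<bar> < h0" for s
      using smooth_on_imp_differentiable[OF smooth_on_dir_deriv_funpow[OF g] inS[OF that]] .
    have d: "((\<lambda>s. (dir_deriv n ^^ m) g (p + s *\<^sub>R n)) has_real_derivative
        (dir_deriv n ^^ Suc m) g (p + s *\<^sub>R n)) (at s)" if "\<bar>s\<bar> < h0" for s
      using has_real_derivative_along_line[OF diff[OF that]] by simp
    have "((\<lambda>s. (dir_deriv n ^^ m) g (p + (- s) *\<^sub>R n)) has_real_derivative
        (dir_deriv n ^^ Suc m) g (p + (- s) *\<^sub>R n) * (- 1)) (at s)"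
    proof (rule DERIV_chain2[where g = "\<lambda>s. - s" and f = "\<lambda>s. (dir_deriv n ^^ m) g (p + s *\<^sub>R n)"])
      show "((\<lambda>s. (dir_deriv n ^^ m) g (p + s *\<^sub>R n)) has_real_derivative
          (dir_deriv n ^^ Suc m) g (p + (- s) *\<^sub>R n)) (at (- s))"
        using that by (intro d) simp
      show "((\<lambda>s. - s) has_real_derivative - 1) (at s)"
        by (auto intro!: derivative_eq_intros)
    qed
    from DERIV_diff[OF d[OF that] DERIV_cmult[OF this, of "(-1) ^ m"]] show ?thesis
      unfolding D_def by simp
  qed
  have "\<exists>t. 0 < t \<and> t < h \<and> (g (p + h *\<^sub>R n) - g (p - h *\<^sub>R n)) / h ^ k = D k t / fact k"
    if h: "0 < h" "h < h0" for h
  proof -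
    have "\<forall>m t. m < k \<and> 0 \<le> t \<and> t \<le> h \<longrightarrow> (D m has_real_derivative D (Suc m) t) (at t)"
      using D_deriv h by auto
    from Maclaurin[OF h(1) odd_pos[OF k] refl this] obtain t where t: "0 < t" "t < h"
      "D 0 h = (\<Sum>m<k. D m 0 / fact m * h ^ m) + D k t / fact k * h ^ k" by blast
    have "D m 0 = 0" if "m < k" for m
      using zero[OF _ that] by (cases "odd m") (simp_all add: D_def)
    then have "D 0 h = D k t / fact k * h ^ k" using t(3) by simp
    then show ?thesis using t h by (intro exI[of _ t]) (simp add: D_def)
  qed
  \<comment> \<open>The Lagrange point as a function of h: squeezed between 0 and h it tends to 0,
    and continuity of \<open>D k\<close> then yields the limit.\<close>
  then obtain \<tau> where \<tau>: "\<And>h. 0 < h \<Longrightarrow> h < h0 \<Longrightarrow> 0 < \<tau> h \<and> \<tau> h < h \<and>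
      (g (p + h *\<^sub>R n) - g (p - h *\<^sub>R n)) / h ^ k = D k (\<tau> h) / fact k" by metis
  have ev: "\<forall>\<^sub>F h in at_right 0. 0 < h \<and> h < h0"
    using eventually_at_right_real[OF h0] by eventually_elim simp
  have "(\<tau> \<longlongrightarrow> 0) (at_right 0)"
    by (rule tendsto_sandwich[of "\<lambda>_. 0" _ _ "\<lambda>h. h"])
      (use ev \<tau> in \<open>auto elim!: eventually_mono intro: less_imp_le tendsto_ident_at\<close>)
  then have "((\<lambda>h. D k (\<tau> h)) \<longlongrightarrow> D k 0) (at_right 0)"
    using DERIV_isCont[OF D_deriv[of 0 k]] h0 by (intro isCont_tendsto_compose[where g="D k"]) auto
  then have "((\<lambda>h. D k (\<tau> h) / fact k) \<longlongrightarrow> D k 0 / fact k) (at_right 0)"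
    by (intro tendsto_intros) auto
  then have "((\<lambda>h. (g (p + h *\<^sub>R n) - g (p - h *\<^sub>R n)) / h ^ k) \<longlongrightarrow> D k 0 / fact k) (at_right 0)"
    by (rule Lim_transform_eventually) (use ev \<tau> in \<open>auto elim!: eventually_mono\<close>)
  then show ?thesis using k by (simp add: D_def)
qed

lemma dir_deriv_funpow_commute:
  fixes f :: "'a::euclidean_space \<Rightarrow> real"
  assumes S: "open S" and f: "smooth_on f S" and x: "x \<in> S"
  shows "(dir_deriv n ^^ k) (dir_deriv e f) x = dir_deriv e ((dir_deriv n ^^ k) f) x"
  using x
proof (induction k arbitrary: x)
  case (Suc k)
  have "(dir_deriv n ^^ Suc k) (dir_deriv e f) x = dir_deriv n (dir_deriv e ((dir_deriv n ^^ k) f)) x"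
    using dir_deriv_cong[OF S Suc.prems Suc.IH] by simp
  also have "\<dots> = dir_deriv e (dir_deriv n ((dir_deriv n ^^ k) f)) x"
    by (rule dir_deriv_commute[OF S smooth_on_dir_deriv_funpow[OF f] Suc.prems])
  finally show ?case by simp
qed simp

text \<open>Only the values of g on H matter, as H contains a segment through p in direction e. H
  will be the half plane of a meridian or a ray from the origin.\<close>

lemma dir_deriv_tangential_eq_0:
  assumes g: "g differentiable at p"
    and tang: "\<forall>\<^sub>F t in nhds 0. p + t *\<^sub>R e \<in> H" and const: "\<And>q. q \<in> H \<Longrightarrow> g q = c"
  shows "dir_deriv e g p = 0"
proof -
  have D: "((\<lambda>t. g (p + t *\<^sub>R e)) has_real_derivative dir_deriv e g p) (at 0)"
    using has_real_derivative_along_line[of g p 0 e] g by simp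
  have "\<forall>\<^sub>F t in nhds 0. g (p + t *\<^sub>R e) = c"
    using tang by (rule eventually_mono) (rule const)
  from D DERIV_cong_ev[OF refl this refl, of "dir_deriv e g p"]
  have "((\<lambda>t. c) has_real_derivative dir_deriv e g p) (at 0)" by simp
  then show ?thesis using DERIV_unique[OF _ DERIV_const] by blast
qed

text \<open>Isolates what the argument uses of the geometry: a set H that is open in the directions
  T, a further direction n, an operator L split along them, and a bound for the odd part of L free
  of derivatives of f. Because of the latter, the bound is two orders smaller in s than the normal
  term whose coefficient is sought.\<close>

lemma odd_normal_derivatives_eq_0:
  fixes f :: "'a::euclidean_space \<Rightarrow> real"
  assumes S: "open S" and f: "smooth_on f S" and H: "H \<subseteq> S"
    and tang: "\<And>p e. p \<in> H \<Longrightarrow> e \<in> T \<Longrightarrow> \<forall>\<^sub>F t in nhds 0. p + t *\<^sub>R e \<in> H"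
    and base: "\<And>p. p \<in> H \<Longrightarrow> dir_deriv n f p = 0"
    and L: "\<And>y. y \<in> S \<Longrightarrow>
      L y = dir_deriv n (dir_deriv n f) y + (\<Sum>e\<in>T. dir_deriv e (dir_deriv e f) y)"
    and bound: "\<And>p. p \<in> H \<Longrightarrow> \<exists>C. \<forall>\<^sub>F s in at_right 0.
      \<bar>L (p + s *\<^sub>R n) - L (p - s *\<^sub>R n)\<bar> \<le> C * \<bar>f (p + s *\<^sub>R n) - f (p - s *\<^sub>R n)\<bar>"
  shows "odd k \<Longrightarrow> p \<in> H \<Longrightarrow> (dir_deriv n ^^ k) f p = 0"
proof (induction k arbitrary: p rule: less_induct)
  case (less k)
  show ?case
  proof (cases "k = 1")
    case True
    then show ?thesis using base less.prems by simp
  next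
    case False
    \<comment> \<open>The odd part of the second normal derivative starts at order j = k - 2 in s;
      every other contribution vanishes in the limit after division by s^j.\<close>
    then obtain j where j: "k = Suc (Suc j)" "odd j"
      using less.prems(1) by (cases k; cases "k - 1") auto
    have p: "p \<in> S" using H less.prems by auto
    note smooth2 = smooth_on_dir_deriv[OF smooth_on_dir_deriv[OF f]]
    have normal: "((\<lambda>h. (dir_deriv n (dir_deriv n f) (p + h *\<^sub>R n) - dir_deriv n (dir_deriv n f) (p - h *\<^sub>R n)) / h ^ j)
        \<longlongrightarrow> 2 * (dir_deriv n ^^ k) f p / fact j) (at_right 0)"
    proof -
      have pow: "(dir_deriv n ^^ m) (dir_deriv n (dir_deriv n f)) = (dir_deriv n ^^ Suc (Suc m)) f" for m
        by (metis funpow_Suc_right o_apply)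
      have "(dir_deriv n ^^ m) (dir_deriv n (dir_deriv n f)) p = 0" if "odd m" "m < j" for m
        unfolding pow by (rule less.IH) (use that j less.prems in auto)
      from odd_difference_limit[OF S smooth2 p j(2) this] show ?thesis
        unfolding pow j(1) .
    qed
    have tangential: "((\<lambda>h. (dir_deriv e (dir_deriv e f) (p + h *\<^sub>R n) - dir_deriv e (dir_deriv e f) (p - h *\<^sub>R n)) / h ^ j)
        \<longlongrightarrow> 0) (at_right 0)" if e: "e \<in> T" for e
    proof -
      \<comment> \<open>Vanishing on all of H survives differentiation along H. This holds for every
        odd m below k, so the tangential part gains the full order k, two more than j.\<close>
      have "(dir_deriv n ^^ m) (dir_deriv e (dir_deriv e f)) p = 0" if m: "odd m" "m < k" for m
      proof -
        let ?g = "(dir_deriv n ^^ m) f"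
        have g: "smooth_on ?g S" by (rule smooth_on_dir_deriv_funpow[OF f])
        have g1: "dir_deriv e ?g q = 0" if "q \<in> H" for q
          by (rule dir_deriv_tangential_eq_0[OF smooth_on_imp_differentiable[OF g] tang[OF that e]])
            (use that H less.IH[OF m(2,1)] in auto)
        have "(dir_deriv n ^^ m) (dir_deriv e (dir_deriv e f)) p =
            dir_deriv e ((dir_deriv n ^^ m) (dir_deriv e f)) p"
          by (rule dir_deriv_funpow_commute[OF S smooth_on_dir_deriv[OF f] p])
        also have "\<dots> = dir_deriv e (dir_deriv e ?g) p"
          by (rule dir_deriv_cong[OF S p]) (rule dir_deriv_funpow_commute[OF S f])
        also have "\<dots> = 0"
          by (rule dir_deriv_tangential_eq_0[OF smooth_on_imp_differentiable[OF smooth_on_dir_deriv[OF g] p]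
                tang[OF less.prems(2) e] g1])
        finally show ?thesis .
      qed
      from odd_difference_limit[OF S smooth2 p less.prems(1) this]
      have "((\<lambda>h. (dir_deriv e (dir_deriv e f) (p + h *\<^sub>R n) - dir_deriv e (dir_deriv e f) (p - h *\<^sub>R n)) / h ^ k * h\<^sup>2)
        \<longlongrightarrow> 2 * (dir_deriv n ^^ k) (dir_deriv e (dir_deriv e f)) p / fact k * 0\<^sup>2) (at_right 0)"
        by (intro tendsto_mult tendsto_power tendsto_ident_at) auto
      then have "((\<lambda>h. (dir_deriv e (dir_deriv e f) (p + h *\<^sub>R n) - dir_deriv e (dir_deriv e f) (p - h *\<^sub>R n)) / h ^ k * h\<^sup>2)
        \<longlongrightarrow> 0) (at_right 0)" by simp
      then show ?thesis
        by (rule Lim_transform_eventually)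
          (use eventually_at_right_less in \<open>auto elim!: eventually_mono simp: j power2_eq_square\<close>)
    qed
    have "((\<lambda>s. p + s *\<^sub>R n) \<longlongrightarrow> p) (at_right 0)" "((\<lambda>s. p - s *\<^sub>R n) \<longlongrightarrow> p) (at_right 0)"
      by (auto intro!: tendsto_eq_intros)
    then have evS: "\<forall>\<^sub>F h in at_right 0. p + h *\<^sub>R n \<in> S \<and> p - h *\<^sub>R n \<in> S"
      using S p by (simp add: topological_tendstoD eventually_conj)
    have "((\<lambda>h. (dir_deriv n (dir_deriv n f) (p + h *\<^sub>R n) - dir_deriv n (dir_deriv n f) (p - h *\<^sub>R n)) / h ^ j +
        (\<Sum>e\<in>T. (dir_deriv e (dir_deriv e f) (p + h *\<^sub>R n) - dir_deriv e (dir_deriv e f) (p - h *\<^sub>R n)) / h ^ j))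
        \<longlongrightarrow> 2 * (dir_deriv n ^^ k) f p / fact j + (\<Sum>e\<in>T. 0)) (at_right 0)"
      by (intro tendsto_add normal tendsto_sum tangential)
    then have "((\<lambda>h. (L (p + h *\<^sub>R n) - L (p - h *\<^sub>R n)) / h ^ j)
        \<longlongrightarrow> 2 * (dir_deriv n ^^ k) f p / fact j + (\<Sum>e\<in>T. 0)) (at_right 0)"
      by (rule Lim_transform_eventually)
        (use evS in \<open>auto elim!: eventually_mono simp: L sum_subtractf diff_divide_distrib add_divide_distrib
          sum_divide_distrib\<close>)
    \<comment> \<open>The same quotient, now estimated by the equation: the odd difference of f is
      of order k, so h^2 remains after division by h^j.\<close>
    moreover have "((\<lambda>h. (L (p + h *\<^sub>R n) - L (p - h *\<^sub>R n)) / h ^ j) \<longlongrightarrow> 0) (at_right 0)"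
    proof -
      obtain C where C: "\<forall>\<^sub>F h in at_right 0.
          \<bar>L (p + h *\<^sub>R n) - L (p - h *\<^sub>R n)\<bar> \<le> C * \<bar>f (p + h *\<^sub>R n) - f (p - h *\<^sub>R n)\<bar>"
        using bound less.prems(2) by blast
      have "((\<lambda>h. (f (p + h *\<^sub>R n) - f (p - h *\<^sub>R n)) / h ^ k) \<longlongrightarrow>
          2 * (dir_deriv n ^^ k) f p / fact k) (at_right 0)"
        by (rule odd_difference_limit[OF S f p less.prems(1)]) (use less.IH less.prems in auto)
      then have "((\<lambda>h. C * \<bar>(f (p + h *\<^sub>R n) - f (p - h *\<^sub>R n)) / h ^ k\<bar> * h\<^sup>2) \<longlongrightarrow>
          C * \<bar>2 * (dir_deriv n ^^ k) f p / fact k\<bar> * 0\<^sup>2) (at_right 0)"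
        by (intro tendsto_mult tendsto_rabs tendsto_power tendsto_ident_at tendsto_const)
      then have lim: "((\<lambda>h. C * \<bar>(f (p + h *\<^sub>R n) - f (p - h *\<^sub>R n)) / h ^ k\<bar> * h\<^sup>2) \<longlongrightarrow> 0) (at_right 0)"
        by simp
      have "\<forall>\<^sub>F h in at_right 0. norm ((L (p + h *\<^sub>R n) - L (p - h *\<^sub>R n)) / h ^ j) \<le>
          C * \<bar>(f (p + h *\<^sub>R n) - f (p - h *\<^sub>R n)) / h ^ k\<bar> * h\<^sup>2"
        using C eventually_at_right_less
      proof eventually_elim
        case (elim h)
        have "norm ((L (p + h *\<^sub>R n) - L (p - h *\<^sub>R n)) / h ^ j) =
            \<bar>L (p + h *\<^sub>R n) - L (p - h *\<^sub>R n)\<bar> / h ^ j"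
          using elim(2) by (simp add: abs_divide)
        also have "\<dots> \<le> C * \<bar>f (p + h *\<^sub>R n) - f (p - h *\<^sub>R n)\<bar> / h ^ j"
          using elim by (intro divide_right_mono) auto
        also have "\<dots> = C * \<bar>(f (p + h *\<^sub>R n) - f (p - h *\<^sub>R n)) / h ^ k\<bar> * h\<^sup>2"
          using elim(2) by (simp add: j abs_divide abs_mult power2_eq_square)
        finally show ?case .
      qed
      then show ?thesis by (rule Lim_null_comparison[OF _ lim])
    qed
    ultimately have "2 * (dir_deriv n ^^ k) f p / fact j + (\<Sum>e\<in>T. 0) = 0"
      by (rule tendsto_unique[OF trivial_limit_at_right_real])
    then show ?thesis by simp
  qed
qed

section \<open>The Laplace-Beltrami operator\<close>

definition laplacian :: "('a::euclidean_space \<Rightarrow> real) \<Rightarrow> 'a \<Rightarrow> real" where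
  "laplacian f x = (\<Sum>b\<in>Basis. dir_deriv b (dir_deriv b f) x)"

lemma smooth_on_sgn_inner:
  fixes b :: "'a::euclidean_space"
  shows "smooth_on (\<lambda>x. sgn x \<bullet> b) (- {0})"
  unfolding smooth_on_def
proof
  fix n
  have o: "open (- {0::'a})" by (rule open_Compl[OF closed_singleton])
  have eq: "(x \<bullet> x) powr (- 1 / 2) * (x \<bullet> b) = sgn x \<bullet> b" if "x \<in> - {0}" for x
  proof -
    have "(x \<bullet> x) powr (- (1 / 2)) = inverse (norm x)"
      using that by (simp add: powr_minus powr_half_sqrt norm_eq_sqrt_inner)
    then show ?thesis by (simp add: sgn_div_norm)
  qed
  show "times_differentiable_on n (\<lambda>x. sgn x \<bullet> b) (- {0})"
    by (rule times_differentiable_on_cong[OF o eq times_differentiable_on_mult[OF o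
          times_differentiable_on_norm_power[OF o] times_differentiable_on_inner]]) auto
qed

text \<open>Near each point u agrees on the sphere with an ambient smooth g, and sgn maps into the
  sphere, so the extension is locally g after sgn, whatever values u takes off the sphere.\<close>

lemma smooth_on_radial_extension:
  fixes u :: "'a::euclidean_space \<Rightarrow> real"
  assumes u: "real_analytic_on u (sphere 0 1)"
  shows "smooth_on (\<lambda>y. u (sgn y)) (- {0})"
  unfolding smooth_on_pointwise[of _ "- {0}"]
proof
  fix x :: 'a assume x: "x \<in> - {0}"
  then have "sgn x \<in> sphere 0 1" by (simp add: norm_sgn)
  then obtain g r where g: "r > 0" "smooth_on g (ball (sgn x) r)"
    "\<And>y. y \<in> ball (sgn x) r \<Longrightarrow> y \<in> sphere 0 1 \<Longrightarrow> u y = g y"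
    using real_analytic_on_local_smooth[OF u] by metis
  define A where "A = (- {0}) \<inter> sgn -` ball (sgn x) r"
  have "continuous_on (- {0}) (sgn :: 'a \<Rightarrow> 'a)"
    by (intro continuous_on_sgn continuous_on_id) auto
  then have A: "open A" unfolding A_def by (intro continuous_open_preimage) auto
  have smooth: "smooth_on (\<lambda>y. g (sgn y)) A"
    by (rule smooth_on_compose[OF A _ smooth_on_subset[OF smooth_on_sgn_inner] g(2)])
      (auto simp: A_def)
  have eq: "g (sgn y) = u (sgn y)" if "y \<in> A" for y
    using that g(3)[of "sgn y"] by (auto simp: A_def norm_sgn)
  have "smooth_on (\<lambda>y. u (sgn y)) A"
    by (rule smooth_on_cong[OF A eq smooth])
  then show "smooth_on (\<lambda>y. u (sgn y)) {x}"
    by (rule smooth_on_subset) (use x g(1) in \<open>auto simp: A_def\<close>)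
qed

lemma dir_deriv_homogeneous:
  fixes f :: "'a::real_normed_vector \<Rightarrow> real"
  assumes S: "open S" "x \<in> S" and hom: "\<And>y. y \<in> S \<Longrightarrow> f (c *\<^sub>R y) = k * f y"
    and f: "f differentiable at x" "f differentiable at (c *\<^sub>R x)"
  shows "c * dir_deriv v f (c *\<^sub>R x) = k * dir_deriv v f x"
proof -
  have "((\<lambda>y. c *\<^sub>R y) has_derivative (\<lambda>v. c *\<^sub>R v)) (at x)"
    by (auto intro!: derivative_eq_intros)
  then have "((\<lambda>y. f (c *\<^sub>R y)) has_derivative (\<lambda>v. dir_deriv (c *\<^sub>R v) f (c *\<^sub>R x))) (at x)"
    by (rule has_derivative_compose) (rule has_derivative_dir_deriv[OF f(2)])
  then have "((\<lambda>y. k * f y) has_derivative (\<lambda>v. dir_deriv (c *\<^sub>R v) f (c *\<^sub>R x))) (at x)"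
    by (rule has_derivative_transform_within_open[OF _ S]) (rule hom)
  moreover have "((\<lambda>y. k * f y) has_derivative (\<lambda>v. k * dir_deriv v f x)) (at x)"
    by (intro has_derivative_mult_right has_derivative_dir_deriv f)
  ultimately have "(\<lambda>v. dir_deriv (c *\<^sub>R v) f (c *\<^sub>R x)) = (\<lambda>v. k * dir_deriv v f x)"
    by (rule has_derivative_unique)
  then show ?thesis
    using linear_cmul[OF linear_dir_deriv[OF f(2)], of c v] by (metis real_scaleR_def)
qed

text \<open>The extension U is homogeneous of degree 0, so its first and second derivatives have
  degrees -1 and -2. The last claim is Euler's relation, as U is constant along rays.\<close>

lemma
  fixes u :: "'a::euclidean_space \<Rightarrow> real"
  assumes u: "real_analytic_on u (sphere 0 1)" and x: "x \<noteq> 0"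
  defines "U \<equiv> \<lambda>y. u (sgn y)"
  shows dir_deriv_radial_extension_scale:
      "c > 0 \<Longrightarrow> c * dir_deriv v U (c *\<^sub>R x) = dir_deriv v U x"
    and dir_deriv2_radial_extension_scale:
      "c > 0 \<Longrightarrow> c\<^sup>2 * dir_deriv w (dir_deriv v U) (c *\<^sub>R x) = dir_deriv w (dir_deriv v U) x"
    and dir_deriv_radial_extension_radial: "dir_deriv x U x = 0"
proof -
  have U: "smooth_on U (- {0})" unfolding U_def by (rule smooth_on_radial_extension[OF u])
  have o: "open (- {0::'a})" by (rule open_Compl[OF closed_singleton])
  have hom: "U (c *\<^sub>R y) = U y" if "c > 0" for c y
    using that by (simp add: U_def sgn_scaleR)
  have 1: "c * dir_deriv v U (c *\<^sub>R x) = dir_deriv v U x" if c: "c > 0" and x: "x \<noteq> 0" for c x v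
    using dir_deriv_homogeneous[OF o, of x U c 1 v] x c hom smooth_on_imp_differentiable[OF U] by simp
  show "c > 0 \<Longrightarrow> c * dir_deriv v U (c *\<^sub>R x) = dir_deriv v U x" by (rule 1[OF _ x])
  show "c\<^sup>2 * dir_deriv w (dir_deriv v U) (c *\<^sub>R x) = dir_deriv w (dir_deriv v U) x" if c: "c > 0"
  proof -
    have hom1: "dir_deriv v U (c *\<^sub>R y) = (1 / c) * dir_deriv v U y" if "y \<in> - {0}" for y
      using 1[OF c, of y] that c by (simp add: field_simps)
    have "c * dir_deriv w (dir_deriv v U) (c *\<^sub>R x) = (1 / c) * dir_deriv w (dir_deriv v U) x"
      by (rule dir_deriv_homogeneous[OF o, of x "dir_deriv v U" c "1 / c" w])
        (use x c hom1 in \<open>auto intro!: smooth_on_imp_differentiable[OF smooth_on_dir_deriv[OF U]]\<close>)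
    then show ?thesis using c by (simp add: field_simps power2_eq_square)
  qed
  have "\<forall>\<^sub>F t in nhds 0. t > (- 1 :: real)"
    by (rule order_tendstoD[OF filterlim_ident]) simp
  then have "\<forall>\<^sub>F t in nhds 0. x + t *\<^sub>R x \<in> {c *\<^sub>R x | c. c > 0}"
  proof eventually_elim
    case (elim t)
    then show ?case by (intro CollectI exI[of _ "1 + t"]) (simp add: scaleR_add_left)
  qed
  from dir_deriv_tangential_eq_0[OF _ this, of U "U x"] show "dir_deriv x U x = 0"
    using x hom smooth_on_imp_differentiable[OF U] by auto
qed

text \<open>Since the gradient of U has degree -1, the radially constant extension of
  \<open>sphere_grad u\<close> is |y| times the gradient of U. The product rule adds only the radial
  derivative of U to the Laplacian, and that is 0.\<close>

lemma laplace_beltrami_eq_laplacian: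
  fixes u :: "'a::euclidean_space \<Rightarrow> real"
  assumes u: "real_analytic_on u (sphere 0 1)" and x: "norm x = 1"
  shows "laplace_beltrami u x = laplacian (\<lambda>y. u (sgn y)) x"
proof -
  define U where "U = (\<lambda>y. u (sgn y))"
  have U: "smooth_on U (- {0})" unfolding U_def by (rule smooth_on_radial_extension[OF u])
  have x0: "x \<noteq> 0" using x by auto
  then have open_nonzero: "open (- {0::'a})" and x_nonzero: "x \<in> - {0}" by auto
  have grad: "sphere_grad u y = (\<Sum>b\<in>Basis. dir_deriv b U y *\<^sub>R b)" for y
    by (simp add: sphere_grad_def dir_deriv_def U_def)
  have grad_sgn: "(\<Sum>b\<in>Basis. (norm y * dir_deriv b U y) *\<^sub>R b) = sphere_grad u (sgn y)"
    if "y \<in> - {0}" for y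
    unfolding grad
  proof (rule sum.cong[OF refl])
    fix b :: 'a
    have "(1 / norm y) * dir_deriv b U ((1 / norm y) *\<^sub>R y) = dir_deriv b U y"
      using dir_deriv_radial_extension_scale[OF u, of y "1 / norm y" b] that unfolding U_def by simp
    then show "(norm y * dir_deriv b U y) *\<^sub>R b = dir_deriv b U (sgn y) *\<^sub>R b"
      using that by (simp add: sgn_div_norm field_simps)
  qed
  have norm_D: "(norm has_derivative (\<lambda>v. v \<bullet> x)) (at x)"
    using has_derivative_norm[OF x0] x by (simp add: sgn_div_norm inner_commute)
  have "((\<lambda>y. \<Sum>b\<in>Basis. (norm y * dir_deriv b U y) *\<^sub>R b) has_derivative
      (\<lambda>v. \<Sum>b\<in>Basis. (norm x * dir_deriv v (dir_deriv b U) x + (v \<bullet> x) * dir_deriv b U x) *\<^sub>R b)) (at x)"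
    by (intro has_derivative_sum has_derivative_scaleR_left has_derivative_mult norm_D
        has_derivative_dir_deriv smooth_on_imp_differentiable[OF smooth_on_dir_deriv[OF U]])
      (use x0 in auto)
  then have "((\<lambda>y. sphere_grad u (sgn y)) has_derivative
      (\<lambda>v. \<Sum>b\<in>Basis. (norm x * dir_deriv v (dir_deriv b U) x + (v \<bullet> x) * dir_deriv b U x) *\<^sub>R b)) (at x)"
    by (rule has_derivative_transform_within_open[OF _ open_nonzero x_nonzero grad_sgn])
  from frechet_derivative_at[OF this, symmetric]
  have "laplace_beltrami u x = (\<Sum>b\<in>Basis. dir_deriv b (dir_deriv b U) x + (b \<bullet> x) * dir_deriv b U x)"
    unfolding laplace_beltrami_def sphere_div_def using x by simp
  also have "\<dots> = laplacian U x + dir_deriv (\<Sum>b\<in>Basis. (x \<bullet> b) *\<^sub>R b) U x"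
  proof -
    have lin: "linear (\<lambda>v. dir_deriv v U x)"
      using x0 by (intro linear_dir_deriv smooth_on_imp_differentiable[OF U]) simp
    show ?thesis
      by (simp add: laplacian_def sum.distrib linear_sum[OF lin] linear_cmul[OF lin] inner_commute)
  qed
  also have "\<dots> = laplacian U x"
    using dir_deriv_radial_extension_radial[OF u x0] by (simp add: euclidean_representation U_def)
  finally show ?thesis by (simp add: U_def)
qed

text \<open>The factor compensates the degree -2 of the Laplacian of the extension.\<close>

lemma laplacian_radial_extension:
  fixes u :: "'a::euclidean_space \<Rightarrow> real"
  assumes u: "real_analytic_on u (sphere 0 1)" and y: "y \<noteq> 0"
  shows "(norm y)\<^sup>2 * laplacian (\<lambda>y. u (sgn y)) y = laplace_beltrami u (sgn y)"
proof -
  have "(1 / norm y)\<^sup>2 * laplacian (\<lambda>y. u (sgn y)) ((1 / norm y) *\<^sub>R y) = laplacian (\<lambda>y. u (sgn y)) y"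
    unfolding laplacian_def sum_distrib_left
    by (intro sum.cong refl dir_deriv2_radial_extension_scale[OF u y]) (use y in simp)
  then have "laplacian (\<lambda>y. u (sgn y)) (sgn y) = (norm y)\<^sup>2 * laplacian (\<lambda>y. u (sgn y)) y"
    using y by (simp add: sgn_div_norm field_simps)
  then show ?thesis
    using laplace_beltrami_eq_laplacian[OF u, of "sgn y"] y by (simp add: norm_sgn)
qed

text \<open>If F a q = F a' q' = 0, the chain \<delta> |q - q'| \<le> |F a' q - F a' q'| = |F a q -
  F a' q| \<le> K |a - a'| gives C = K / \<delta>. The value q' is unrestricted because the lower
  bound is global in q and K is used only at the height q.\<close>

lemma elliptic_zero_set_lipschitz:
  fixes F :: "real \<Rightarrow> real \<Rightarrow> real"
  assumes F: "real_analytic_on (\<lambda>(a, q). F a q) UNIV"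
    and elliptic: "\<delta> > 0" "\<And>a q. deriv (\<lambda>s. F a s) q \<ge> \<delta>"
  obtains C r where "r > 0" "\<And>a a' q q'. \<bar>a - a0\<bar> < r \<Longrightarrow> \<bar>a' - a0\<bar> < r \<Longrightarrow> \<bar>q - q0\<bar> < r \<Longrightarrow>
    F a q = 0 \<Longrightarrow> F a' q' = 0 \<Longrightarrow> \<bar>q - q'\<bar> \<le> C * \<bar>a - a'\<bar>"
proof -
  define f where "f = (\<lambda>(a, q). F a q)"
  have f: "smooth_on f UNIV" unfolding f_def by (rule real_analytic_on_UNIV_imp_smooth_on[OF F])
  have D1: "((\<lambda>a. F a q) has_real_derivative dir_deriv (1, 0) f (a, q)) (at a)" for a q
    using has_real_derivative_along_line[OF smooth_on_imp_differentiable[OF f], of "(0, q)" a "(1, 0)"]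
    by (simp add: f_def)
  \<comment> \<open>Turns \<open>deriv\<close>, in which ellipticity is stated, into a genuine
    derivative for the mean value theorem.\<close>
  have D2: "((\<lambda>q. F a q) has_real_derivative deriv (\<lambda>q. F a q) q) (at q)" for a q
  proof -
    have "((\<lambda>q. F a q) has_real_derivative dir_deriv (0, 1) f (a, q)) (at q)"
      using has_real_derivative_along_line[OF smooth_on_imp_differentiable[OF f], of "(a, 0)" q "(0, 1)"]
      by (simp add: f_def)
    then show ?thesis using DERIV_imp_deriv by metis
  qed
  have lower: "\<delta> * \<bar>q - q'\<bar> \<le> \<bar>F a q - F a q'\<bar>" for a q q'
  proof -
    have "\<delta> * (q' - q) \<le> F a q' - F a q" if less: "q < q'" for q q'
    proof -
      obtain z where z: "F a q' - F a q = (q' - q) * deriv (\<lambda>q. F a q) z"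
        using MVT2[OF less, of "F a" "deriv (F a)", OF D2] by blast
      have "(q' - q) * \<delta> \<le> (q' - q) * deriv (\<lambda>q. F a q) z"
        using elliptic(2)[of a z] less by (intro mult_left_mono) auto
      then show ?thesis unfolding z by (simp only: mult.commute)
    qed
    note le = this
    consider "q < q'" | "q = q'" | "q' < q" by linarith
    then show ?thesis
    proof cases
      case 1
      then show ?thesis using le[OF 1] by simp
    next
      case 3
      then show ?thesis using le[OF 3] by simp
    qed simp
  qed
  define K where "K = \<bar>dir_deriv (1, 0) f (a0, q0)\<bar> + 1"
  have "isCont (dir_deriv (1, 0) f) (a0, q0)"
    using smooth_on_imp_continuous_on[OF smooth_on_dir_deriv[OF f]] by (simp add: continuous_on_eq_continuous_at)
  then obtain d where d: "d > 0" "\<And>z. dist z (a0, q0) < d \<Longrightarrow>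
      dist (dir_deriv (1, 0) f z) (dir_deriv (1, 0) f (a0, q0)) < 1"
    unfolding continuous_at_eps_delta by (metis zero_less_one)
  have K: "\<bar>dir_deriv (1, 0) f (a, q)\<bar> \<le> K" if "\<bar>a - a0\<bar> < d / 2" "\<bar>q - q0\<bar> < d / 2" for a q
  proof -
    have "dist (a, q) (a0, q0) \<le> \<bar>a - a0\<bar> + \<bar>q - q0\<bar>"
      using sqrt_sum_squares_le_sum_abs[of "a - a0" "q - q0"]
      by (simp add: dist_Pair_Pair dist_real_def)
    also have "\<dots> < d" using that by argo
    finally have "\<bar>dir_deriv (1, 0) f (a, q) - dir_deriv (1, 0) f (a0, q0)\<bar> < 1"
      using d(2) by (simp add: dist_real_def)
    then show ?thesis unfolding K_def by linarith
  qed
  show ?thesis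
  proof (rule that[of "d / 2" "K / \<delta>"])
    show "d / 2 > 0" using d by simp
    fix a a' q q' assume *: "\<bar>a - a0\<bar> < d / 2" "\<bar>a' - a0\<bar> < d / 2" "\<bar>q - q0\<bar> < d / 2"
      "F a q = 0" "F a' q' = 0"
    have "norm (F a q - F a' q) \<le> K * norm (a - a')"
    proof (rule field_differentiable_bound[where S = "ball a0 (d / 2)"])
      show "((\<lambda>a. F a q) has_field_derivative dir_deriv (1, 0) f (z, q)) (at z within ball a0 (d / 2))" for z
        using D1 by (rule has_field_derivative_at_within)
    qed (use * K in \<open>auto simp: dist_real_def abs_minus_commute\<close>)
    then have "\<bar>F a' q - F a' q'\<bar> \<le> K * \<bar>a - a'\<bar>" using * by simp
    then have "\<delta> * \<bar>q - q'\<bar> \<le> K * \<bar>a - a'\<bar>" using lower[of q q' a'] by linarith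
    then show "\<bar>q - q'\<bar> \<le> K / \<delta> * \<bar>a - a'\<bar>" using elliptic(1) by (simp add: field_simps)
  qed
qed

section \<open>Symmetry about the meridian of an axial extremum\<close>

lemma sum_Basis_vec3:
  fixes g :: "real^3 \<Rightarrow> real"
  shows "sum g Basis = g (vector [1, 0, 0]) + g (vector [0, 1, 0]) + g (vector [0, 0, 1])"
proof -
  have ax: "axis 1 1 = (vector [1, 0, 0] :: real^3)" "axis 2 1 = (vector [0, 1, 0] :: real^3)"
    "axis 3 1 = (vector [0, 0, 1] :: real^3)"
    by (simp_all add: vec_eq_iff forall_3 axis_def)
  have B: "Basis = {axis 1 1, axis 2 1, axis 3 (1::real) :: real^3}"
    by (auto simp: Basis_vec_def UNIV_3)
  have "sum g Basis = g (axis 1 1) + g (axis 2 1) + g (axis 3 1)"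
    unfolding B by (simp add: axis_eq_axis)
  then show ?thesis by (simp only: ax)
qed

text \<open>The unit normal to the plane of the meridian \<phi>; \<open>equatorial \<phi>\<close>
  and \<open>polar_axis\<close> span that plane.\<close>

definition azimuthal :: "real \<Rightarrow> real^3" where
  "azimuthal \<phi> = vector [- sin \<phi>, cos \<phi>, 0]"

definition equatorial :: "real \<Rightarrow> real^3" where
  "equatorial \<phi> = vector [cos \<phi>, sin \<phi>, 0]"

definition polar_axis :: "real^3" where
  "polar_axis = vector [0, 0, 1]"

lemmas frame_defs = azimuthal_def equatorial_def polar_axis_def

text \<open>Relative to \<phi>, the longitude derivative at \<psi> = \<phi> is visibly sin \<theta>
  times \<open>azimuthal \<phi>\<close>, and \<psi> \<mapsto> 2\<phi> - \<psi> only flips the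
  azimuthal component.\<close>

lemma spherical_eq_frame:
  "spherical \<theta> \<psi> = (sin \<theta> * cos (\<psi> - \<phi>)) *\<^sub>R equatorial \<phi> +
    (sin \<theta> * sin (\<psi> - \<phi>)) *\<^sub>R azimuthal \<phi> + cos \<theta> *\<^sub>R polar_axis"
proof -
  define d where "d = \<psi> - \<phi>"
  have "\<psi> = d + \<phi>" by (simp add: d_def)
  then show ?thesis
    by (simp add: spherical_def frame_defs vec_eq_iff forall_3 cos_add sin_add algebra_simps)
qed

lemma frame_inner [simp]:
  "azimuthal \<phi> \<bullet> azimuthal \<phi> = 1" "equatorial \<phi> \<bullet> equatorial \<phi> = 1" "polar_axis \<bullet> polar_axis = 1"
  "azimuthal \<phi> \<bullet> equatorial \<phi> = 0" "equatorial \<phi> \<bullet> azimuthal \<phi> = 0"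
  "azimuthal \<phi> \<bullet> polar_axis = 0" "polar_axis \<bullet> azimuthal \<phi> = 0"
  "equatorial \<phi> \<bullet> polar_axis = 0" "polar_axis \<bullet> equatorial \<phi> = 0"
  using sin_cos_squared_add3[of \<phi>]
  by (simp_all add: frame_defs inner_vec_def sum_3 add.commute)

lemma norm_spherical [simp]: "norm (spherical \<theta> \<psi>) = 1"
proof -
  have "spherical \<theta> \<psi> \<bullet> spherical \<theta> \<psi> = 1"
    using sin_cos_squared_add3[of \<theta>]
    by (simp add: spherical_eq_frame[of \<theta> \<psi> \<psi>] inner_add_left inner_add_right add.commute)
  then show ?thesis by (simp add: norm_eq_sqrt_inner)
qed

lemma spherical_nonzero: "spherical \<theta> \<psi> \<noteq> 0"
  using norm_spherical[of \<theta> \<psi>] by force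

text \<open>Rotation invariance within the horizontal plane: the squares of the coefficients add up
  to 1 and the mixed terms cancel. The result has the split form that
  \<open>odd_normal_derivatives_eq_0\<close> expects.\<close>

lemma laplacian_frame:
  fixes f :: "real^3 \<Rightarrow> real"
  assumes S: "open S" and f: "smooth_on f S" and y: "y \<in> S"
  shows "laplacian f y = dir_deriv (azimuthal \<phi>) (dir_deriv (azimuthal \<phi>) f) y +
    (\<Sum>e\<in>{equatorial \<phi>, polar_axis}. dir_deriv e (dir_deriv e f) y)"
proof -
  define X Y :: "real^3" where "X = vector [1, 0, 0]" and "Y = vector [0, 1, 0]"
  have second: "dir_deriv (a *\<^sub>R X + b *\<^sub>R Y) (dir_deriv (a *\<^sub>R X + b *\<^sub>R Y) f) y =
    a * a * dir_deriv X (dir_deriv X f) y + a * b * dir_deriv X (dir_deriv Y f) y +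
    b * a * dir_deriv Y (dir_deriv X f) y + b * b * dir_deriv Y (dir_deriv Y f) y" for a b
  proof -
    have lin: "dir_deriv (a *\<^sub>R X + b *\<^sub>R Y) g z = a * dir_deriv X g z + b * dir_deriv Y g z"
      if "g differentiable at z" for g z
      by (simp add: linear_add[OF linear_dir_deriv[OF that]] linear_cmul[OF linear_dir_deriv[OF that]])
    have diff: "dir_deriv v f differentiable at y" for v
      by (rule smooth_on_imp_differentiable[OF smooth_on_dir_deriv[OF f] y])
    have "dir_deriv (a *\<^sub>R X + b *\<^sub>R Y) (dir_deriv (a *\<^sub>R X + b *\<^sub>R Y) f) y =
        dir_deriv (a *\<^sub>R X + b *\<^sub>R Y) (\<lambda>z. a * dir_deriv X f z + b * dir_deriv Y f z) y"
      by (rule dir_deriv_cong[OF S y]) (rule lin[OF smooth_on_imp_differentiable[OF f]])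
    also have "\<dots> = a * dir_deriv (a *\<^sub>R X + b *\<^sub>R Y) (dir_deriv X f) y +
        b * dir_deriv (a *\<^sub>R X + b *\<^sub>R Y) (dir_deriv Y f) y"
      by (intro dir_deriv_eqI has_derivative_add has_derivative_mult_right has_derivative_dir_deriv diff)
    finally show ?thesis by (simp add: lin[OF diff] algebra_simps)
  qed
  have az: "azimuthal \<phi> = (- sin \<phi>) *\<^sub>R X + cos \<phi> *\<^sub>R Y"
    and eq: "equatorial \<phi> = cos \<phi> *\<^sub>R X + sin \<phi> *\<^sub>R Y"
    by (simp_all add: frame_defs X_def Y_def vec_eq_iff forall_3)
  \<comment> \<open>Otherwise the sum over the set of the two directions would have one term
    only.\<close>
  have ne: "equatorial \<phi> \<noteq> polar_axis"
    by (simp add: frame_defs vec_eq_iff forall_3)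
  have "dir_deriv (azimuthal \<phi>) (dir_deriv (azimuthal \<phi>) f) y +
      dir_deriv (equatorial \<phi>) (dir_deriv (equatorial \<phi>) f) y =
      (sin \<phi> * sin \<phi> + cos \<phi> * cos \<phi>) * dir_deriv X (dir_deriv X f) y +
      (sin \<phi> * sin \<phi> + cos \<phi> * cos \<phi>) * dir_deriv Y (dir_deriv Y f) y"
    unfolding az eq second by algebra
  also have "\<dots> = dir_deriv X (dir_deriv X f) y + dir_deriv Y (dir_deriv Y f) y"
  proof -
    have "sin \<phi> * sin \<phi> + cos \<phi> * cos \<phi> = 1"
      using sin_cos_squared_add3[of \<phi>] by (simp only: add.commute)
    then show ?thesis by (simp only: mult_1)
  qed
  finally show ?thesis
    using ne by (simp add: laplacian_def sum_Basis_vec3 X_def Y_def polar_axis_def)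
qed

text \<open>The cone over the meridian without its poles. The condition a > 0 leaves out the polar
  axis and the opposite meridian, yet keeps the set open in its plane.\<close>

definition half_plane :: "real \<Rightarrow> (real^3) set" where
  "half_plane \<phi> = {a *\<^sub>R equatorial \<phi> + b *\<^sub>R polar_axis | a b. a > 0}"

lemma half_plane_inner_azimuthal: "p \<in> half_plane \<phi> \<Longrightarrow> p \<bullet> azimuthal \<phi> = 0"
  by (auto simp: half_plane_def inner_add_left)

lemma half_plane_nonzero: "p \<in> half_plane \<phi> \<Longrightarrow> p \<noteq> 0"
proof -
  assume "p \<in> half_plane \<phi>"
  then have "p \<bullet> equatorial \<phi> > 0" by (auto simp: half_plane_def inner_add_left)
  then show "p \<noteq> 0" by auto
qed

lemma half_plane_tangential:
  assumes "p \<in> half_plane \<phi>" "e \<in> {equatorial \<phi>, polar_axis}"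
  shows "\<forall>\<^sub>F t in nhds 0. p + t *\<^sub>R e \<in> half_plane \<phi>"
proof -
  obtain a b where p: "p = a *\<^sub>R equatorial \<phi> + b *\<^sub>R polar_axis" and a: "a > 0"
    using assms(1) by (auto simp: half_plane_def)
  have "\<forall>\<^sub>F t in nhds 0. t > - a"
    by (rule order_tendstoD[OF filterlim_ident]) (use a in simp)
  then show ?thesis
  proof eventually_elim
    case (elim t)
    consider "e = equatorial \<phi>" | "e = polar_axis" using assms(2) by auto
    then show ?case
    proof cases
      case 1
      then have "p + t *\<^sub>R e = (a + t) *\<^sub>R equatorial \<phi> + b *\<^sub>R polar_axis"
        by (simp add: p algebra_simps)
      then show ?thesis unfolding half_plane_def using elim by force
    next
      case 2
      then have "p + t *\<^sub>R e = a *\<^sub>R equatorial \<phi> + (b + t) *\<^sub>R polar_axis"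
        by (simp add: p algebra_simps)
      then show ?thesis unfolding half_plane_def using a by blast
    qed
  qed
qed

text \<open>The equality gives both points the same factor |y|^2 in the equation; the inequality
  keeps the normal line away from the origin when p is nonzero.\<close>

lemma norm_perpendicular:
  fixes p n :: "'a::real_inner"
  assumes "p \<bullet> n = 0"
  shows "norm (p + s *\<^sub>R n) = norm (p - s *\<^sub>R n)" "norm p \<le> norm (p + s *\<^sub>R n)"
proof -
  have "norm (p + s *\<^sub>R n) = sqrt ((norm p)\<^sup>2 + (s * norm n)\<^sup>2)" for s
    using assms
    by (simp add: norm_eq_sqrt_inner inner_add_left inner_add_right inner_commute power_mult_distrib
        power2_eq_square)
  from this[of s] this[of "- s"] show "norm (p + s *\<^sub>R n) = norm (p - s *\<^sub>R n)"
    "norm p \<le> norm (p + s *\<^sub>R n)"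
    by (auto intro: real_le_rsqrt)
qed

text \<open>On the meridian the longitude derivative is sin \<theta> times the derivative along
  \<open>azimuthal \<phi>\<close>, and sin \<theta> > 0 off the poles; homogeneity carries the
  result from the sphere to the ray.\<close>

lemma azimuthal_derivative_eq_0:
  assumes u: "real_analytic_on u (sphere 0 1)" and ext: "axial_extremum u \<phi>" and p: "p \<in> half_plane \<phi>"
  shows "dir_deriv (azimuthal \<phi>) (\<lambda>y. u (sgn y)) p = 0"
proof -
  define U where "U = (\<lambda>y. u (sgn y))"
  have U: "smooth_on U (- {0})" unfolding U_def by (rule smooth_on_radial_extension[OF u])
  obtain a b where p_eq: "p = a *\<^sub>R equatorial \<phi> + b *\<^sub>R polar_axis" and a: "a > 0"
    using p by (auto simp: half_plane_def)
  define r where "r = norm p"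
  have r: "r > 0" using half_plane_nonzero[OF p] by (simp add: r_def)
  have r2: "(a / r)\<^sup>2 + (b / r)\<^sup>2 = 1"
  proof -
    have "r\<^sup>2 = a\<^sup>2 + b\<^sup>2"
      unfolding r_def power2_norm_eq_inner
      by (simp add: p_eq inner_add_left inner_add_right power2_eq_square)
    then show ?thesis using r a by (simp add: power_divide add_divide_distrib[symmetric])
  qed
  define \<theta> where "\<theta> = arccos (b / r)"
  have "(b / r)\<^sup>2 \<le> 1" using r2 zero_le_power2[of "a / r"] by linarith
  then have "\<bar>b / r\<bar> \<le> 1" by (simp only: abs_square_le_1)
  then have "- 1 \<le> b / r" "b / r \<le> 1" by linarith+
  then have \<theta>: "0 \<le> \<theta>" "\<theta> \<le> pi" "cos \<theta> = b / r"
    unfolding \<theta>_def by (rule arccos_lbound arccos_ubound cos_arccos; assumption)+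
  have sin: "sin \<theta> = a / r"
  proof -
    have "(sin \<theta>)\<^sup>2 = (a / r)\<^sup>2" using r2 sin_cos_squared_add[of \<theta>] unfolding \<theta>(3) by simp
    then show ?thesis using sin_ge_zero[OF \<theta>(1,2)] a r by (simp add: power2_eq_iff_nonneg)
  qed
  have "spherical \<theta> \<phi> = (1 / r) *\<^sub>R p"
    using spherical_eq_frame[of \<theta> \<phi> \<phi>] by (simp add: sin \<theta>(3) p_eq scaleR_add_right)
  then have p': "p = r *\<^sub>R spherical \<theta> \<phi>" using r by simp
  note s0 = spherical_nonzero[of \<theta> \<phi>]
  have "((\<lambda>\<psi>. spherical \<theta> \<psi>) has_derivative (\<lambda>t. t *\<^sub>R (sin \<theta> *\<^sub>R azimuthal \<phi>))) (at \<phi>)"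
    unfolding spherical_eq_frame[of \<theta> _ \<phi>]
    by (auto intro!: derivative_eq_intros)
  then have "((\<lambda>\<psi>. U (spherical \<theta> \<psi>)) has_derivative
      (\<lambda>t. dir_deriv (t *\<^sub>R (sin \<theta> *\<^sub>R azimuthal \<phi>)) U (spherical \<theta> \<phi>))) (at \<phi>)"
    by (rule has_derivative_compose)
      (intro has_derivative_dir_deriv smooth_on_imp_differentiable[OF U], use s0 in simp)
  moreover have "(\<lambda>t. dir_deriv (t *\<^sub>R (sin \<theta> *\<^sub>R azimuthal \<phi>)) U (spherical \<theta> \<phi>)) =
      (*) (sin \<theta> * dir_deriv (azimuthal \<phi>) U (spherical \<theta> \<phi>))"
  proof -
    have "linear (\<lambda>v. dir_deriv v U (spherical \<theta> \<phi>))"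
      using s0 by (intro linear_dir_deriv smooth_on_imp_differentiable[OF U]) simp
    from linear_cmul[OF this] show ?thesis by (simp only: fun_eq_iff real_scaleR_def) simp
  qed
  ultimately have "((\<lambda>\<psi>. U (spherical \<theta> \<psi>)) has_real_derivative
      sin \<theta> * dir_deriv (azimuthal \<phi>) U (spherical \<theta> \<phi>)) (at \<phi>)"
    by (simp only: has_field_derivative_def)
  moreover have "(\<lambda>\<psi>. U (spherical \<theta> \<psi>)) = (\<lambda>\<psi>. u (spherical \<theta> \<psi>))"
    by (simp add: U_def sgn_div_norm)
  ultimately have "deriv_azimuth u \<theta> \<phi> = sin \<theta> * dir_deriv (azimuthal \<phi>) U (spherical \<theta> \<phi>)"
    unfolding deriv_azimuth_def by (simp add: DERIV_imp_deriv)
  then have "dir_deriv (azimuthal \<phi>) U (spherical \<theta> \<phi>) = 0"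
    using ext \<theta> sin a r by (simp add: axial_extremum_def)
  then have "r * dir_deriv (azimuthal \<phi>) U p = 0"
    using dir_deriv_radial_extension_scale[OF u s0 r, of "azimuthal \<phi>"] unfolding p' U_def by simp
  then show ?thesis using r by (simp add: U_def)
qed

context
  fixes F :: "real \<Rightarrow> real \<Rightarrow> real" and \<delta> \<phi> :: real and u :: "real^3 \<Rightarrow> real"
  assumes F_analytic: "real_analytic_on (\<lambda>(a, q). F a q) UNIV"
    and elliptic: "\<delta> > 0" "\<And>a q. deriv (\<lambda>s. F a s) q \<ge> \<delta>"
    and u_analytic: "real_analytic_on u (sphere 0 1)"
    and solution: "\<And>x. x \<in> sphere 0 1 \<Longrightarrow> 0 = F (u x) (laplace_beltrami u x)"
    and extremum: "axial_extremum u \<phi>"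
begin

private abbreviation "U \<equiv> \<lambda>y. u (sgn y)"
private abbreviation "n \<equiv> azimuthal \<phi>"

private lemma smooth_U: "smooth_on U (- {0})"
  by (rule smooth_on_radial_extension[OF u_analytic])

text \<open>By homogeneity W is the Laplace-Beltrami term at the projected point, so (U, W) stays in
  the zero set of F, where the Lipschitz estimate holds near p. As the two points have equal norm,
  the difference of W is one common factor times that of the Laplacian.\<close>

private lemma laplacian_odd_difference_bound:
  assumes p: "p \<in> half_plane \<phi>"
  shows "\<exists>C. \<forall>\<^sub>F s in at_right 0. \<bar>laplacian U (p + s *\<^sub>R n) - laplacian U (p - s *\<^sub>R n)\<bar>
    \<le> C * \<bar>U (p + s *\<^sub>R n) - U (p - s *\<^sub>R n)\<bar>"
proof -
  define W where "W y = (norm y)\<^sup>2 * laplacian U y" for y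
  have p0: "p \<noteq> 0" by (rule half_plane_nonzero[OF p])
  have F0: "F (U y) (W y) = 0" if "y \<noteq> 0" for y
    using solution[of "sgn y"] laplacian_radial_extension[OF u_analytic that] that
    by (simp add: W_def norm_sgn)
  have "continuous_on (- {0}) W"
    unfolding W_def laplacian_def
    by (intro continuous_intros smooth_on_imp_continuous_on smooth_on_dir_deriv smooth_U)
  moreover have "continuous_on (- {0}) U" by (rule smooth_on_imp_continuous_on[OF smooth_U])
  moreover have "open (- {0::real^3})" by (rule open_Compl[OF closed_singleton])
  ultimately have cont: "isCont U p" "isCont W p"
    using p0 by (auto simp: continuous_on_eq_continuous_at)
  obtain C r where r: "r > 0" and lip: "\<And>a a' q q'. \<bar>a - U p\<bar> < r \<Longrightarrow> \<bar>a' - U p\<bar> < r \<Longrightarrow>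
      \<bar>q - W p\<bar> < r \<Longrightarrow> F a q = 0 \<Longrightarrow> F a' q' = 0 \<Longrightarrow> \<bar>q - q'\<bar> \<le> C * \<bar>a - a'\<bar>"
    using elliptic_zero_set_lipschitz[OF F_analytic elliptic] by metis
  have lim: "((\<lambda>s. p + s *\<^sub>R n) \<longlongrightarrow> p) (at_right 0)" "((\<lambda>s. p - s *\<^sub>R n) \<longlongrightarrow> p) (at_right 0)"
    by (auto intro!: tendsto_eq_intros)
  have ev: "\<forall>\<^sub>F s in at_right 0. dist (U (p + s *\<^sub>R n)) (U p) < r"
    "\<forall>\<^sub>F s in at_right 0. dist (U (p - s *\<^sub>R n)) (U p) < r"
    "\<forall>\<^sub>F s in at_right 0. dist (W (p + s *\<^sub>R n)) (W p) < r"
    by (rule tendstoD[OF isCont_tendsto_compose[OF cont(1) lim(1)] r]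
        tendstoD[OF isCont_tendsto_compose[OF cont(1) lim(2)] r]
        tendstoD[OF isCont_tendsto_compose[OF cont(2) lim(1)] r])+
  have "\<forall>\<^sub>F s in at_right 0. \<bar>laplacian U (p + s *\<^sub>R n) - laplacian U (p - s *\<^sub>R n)\<bar>
      \<le> \<bar>C\<bar> / (norm p)\<^sup>2 * \<bar>U (p + s *\<^sub>R n) - U (p - s *\<^sub>R n)\<bar>"
    using ev
  proof eventually_elim
    case (elim s)
    let ?x = "p + s *\<^sub>R n" and ?y = "p - s *\<^sub>R n"
    note perp = norm_perpendicular[OF half_plane_inner_azimuthal[OF p], of s]
    have pos: "norm p > 0" using p0 by simp
    then have "norm ?x > 0" "norm ?y > 0" using perp by linarith+
    then have nz: "?x \<noteq> 0" "?y \<noteq> 0" by auto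
    have "\<bar>W ?x - W ?y\<bar> \<le> C * \<bar>U ?x - U ?y\<bar>"
      by (rule lip) (use elim F0[OF nz(1)] F0[OF nz(2)] in \<open>auto simp: dist_real_def\<close>)
    also have "\<dots> \<le> \<bar>C\<bar> * \<bar>U ?x - U ?y\<bar>" by (intro mult_right_mono) auto
    also have "W ?x - W ?y = (norm ?x)\<^sup>2 * (laplacian U ?x - laplacian U ?y)"
      unfolding W_def perp(1)[symmetric] by (simp add: right_diff_distrib)
    finally have "(norm ?x)\<^sup>2 * \<bar>laplacian U ?x - laplacian U ?y\<bar> \<le> \<bar>C\<bar> * \<bar>U ?x - U ?y\<bar>"
      by (simp add: abs_mult)
    moreover have "(norm p)\<^sup>2 * \<bar>laplacian U ?x - laplacian U ?y\<bar> \<le>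
        (norm ?x)\<^sup>2 * \<bar>laplacian U ?x - laplacian U ?y\<bar>"
      using perp(2) by (intro mult_right_mono power_mono) auto
    ultimately have "(norm p)\<^sup>2 * \<bar>laplacian U ?x - laplacian U ?y\<bar> \<le> \<bar>C\<bar> * \<bar>U ?x - U ?y\<bar>"
      by linarith
    then show ?case using pos by (simp add: field_simps)
  qed
  then show ?thesis by blast
qed

private lemma odd_azimuthal_derivatives_eq_0:
  "odd k \<Longrightarrow> p \<in> half_plane \<phi> \<Longrightarrow> (dir_deriv n ^^ k) U p = 0"
proof (rule odd_normal_derivatives_eq_0[where S = "- {0}" and H = "half_plane \<phi>" and
      T = "{equatorial \<phi>, polar_axis}" and L = "laplacian U"])
  show o: "open (- {0::real^3})" by (rule open_Compl[OF closed_singleton])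
  show "half_plane \<phi> \<subseteq> - {0}" using half_plane_nonzero by auto
  show "laplacian U y = dir_deriv n (dir_deriv n U) y +
      (\<Sum>e\<in>{equatorial \<phi>, polar_axis}. dir_deriv e (dir_deriv e U) y)" if "y \<in> - {0}" for y
    by (rule laplacian_frame[OF o smooth_U that])
qed (use smooth_U half_plane_tangential azimuthal_derivative_eq_0[OF u_analytic extremum]
      laplacian_odd_difference_bound in auto)

private lemma odd_difference_flat:
  assumes p: "p \<in> half_plane \<phi>"
  obtains d where "d > 0" "\<And>s. 0 < s \<Longrightarrow> s < d \<Longrightarrow> \<bar>U (p + s *\<^sub>R n) - U (p - s *\<^sub>R n)\<bar> \<le> s ^ m"
proof -
  \<comment> \<open>Only odd orders are available; 2m + 1 is one that is at least m, and s < 1 then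
    lowers the exponent to m.\<close>
  define k where "k = 2 * m + 1"
  have k: "odd k" by (simp add: k_def)
  have p': "p \<in> - {0}" using half_plane_nonzero[OF p] by simp
  have "((\<lambda>h. (U (p + h *\<^sub>R n) - U (p - h *\<^sub>R n)) / h ^ k) \<longlongrightarrow>
      2 * (dir_deriv n ^^ k) U p / fact k) (at_right 0)"
    by (rule odd_difference_limit[OF open_Compl[OF closed_singleton] smooth_U p' k])
      (rule odd_azimuthal_derivatives_eq_0[OF _ p])
  then have "((\<lambda>h. (U (p + h *\<^sub>R n) - U (p - h *\<^sub>R n)) / h ^ k) \<longlongrightarrow> 0) (at_right 0)"
    using odd_azimuthal_derivatives_eq_0[OF k p] by simp
  from tendstoD[OF this zero_less_one]
  obtain d where d: "d > 0"
    "\<And>s. 0 < s \<Longrightarrow> s < d \<Longrightarrow> \<bar>(U (p + s *\<^sub>R n) - U (p - s *\<^sub>R n)) / s ^ k\<bar> < 1"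
    unfolding eventually_at_right_field by (auto simp: dist_real_def)
  show ?thesis
  proof (rule that[of "min d 1"])
    show "min d 1 > 0" using d by simp
    fix s :: real assume s: "0 < s" "s < min d 1"
    have "\<bar>U (p + s *\<^sub>R n) - U (p - s *\<^sub>R n)\<bar> \<le> s ^ k"
      using d(2)[of s] s by (simp add: abs_divide divide_less_eq)
    also have "\<dots> \<le> s ^ m" using s by (intro power_decreasing) (auto simp: k_def)
    finally show "\<bar>U (p + s *\<^sub>R n) - U (p - s *\<^sub>R n)\<bar> \<le> s ^ m" .
  qed
qed

text \<open>For small t the point cos t p + sin t n is the projection of p + tan t n, so flatness
  along the tangent line becomes flatness in t at 0. The circle has entire coordinate functions, and
  the identity theorem carries the symmetry around all of it, past t = \<pi>/2 where the line
  ends.\<close>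

private lemma great_circle_symmetric:
  assumes p: "p \<in> half_plane \<phi>" "norm p = 1"
  shows "u (cos t *\<^sub>R p + sin t *\<^sub>R n) = u (cos t *\<^sub>R p - sin t *\<^sub>R n)"
proof -
  define \<gamma> where "\<gamma> \<sigma> t = cos t *\<^sub>R p + (\<sigma> * sin t) *\<^sub>R n" for \<sigma> t :: real
  define Q where "Q t = u (\<gamma> 1 t) - u (\<gamma> (- 1) t)" for t
  have pn: "p \<bullet> n = 0" "n \<bullet> p = 0" "p \<bullet> p = 1"
    using half_plane_inner_azimuthal[OF p(1)] p(2) by (auto simp: inner_commute norm_eq_1)
  have \<gamma>: "\<gamma> \<sigma> t \<in> sphere 0 1" if "\<sigma> * \<sigma> = 1" for \<sigma> t
  proof -
    have "\<gamma> \<sigma> t \<bullet> \<gamma> \<sigma> t = cos t * cos t + (\<sigma> * \<sigma>) * (sin t * sin t)"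
      by (simp add: \<gamma>_def inner_add_left inner_add_right pn)
    also have "\<dots> = 1" using that by simp
    finally show ?thesis by (simp add: norm_eq_1)
  qed
  have ext: "\<exists>g e. e > 0 \<and> g holomorphic_on ball (of_real t0) e \<and>
      (\<forall>t. \<bar>t - t0\<bar> < e \<longrightarrow> g (of_real t) = complex_of_real (u (\<gamma> \<sigma> t)))" if "\<sigma> * \<sigma> = 1" for \<sigma> t0
  proof (rule real_analytic_on_compose_entire[where \<gamma> = "\<gamma> \<sigma>" and ?t0.0 = t0 and
        \<Gamma> = "\<lambda>b z. cos z * of_real (p \<bullet> b) + of_real \<sigma> * sin z * of_real (n \<bullet> b)",
        OF u_analytic \<gamma>[OF that]])
    show "(\<lambda>z. cos z * complex_of_real (p \<bullet> b) + of_real \<sigma> * sin z * of_real (n \<bullet> b)) holomorphic_on UNIV" for b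
      by (intro holomorphic_intros)
    show "cos (complex_of_real t) * of_real (p \<bullet> b) + of_real \<sigma> * sin (of_real t) * of_real (n \<bullet> b) =
        of_real (\<gamma> \<sigma> t \<bullet> b)" for b t
      by (simp add: \<gamma>_def inner_add_left cos_of_real sin_of_real)
  qed blast
  have "Q t = 0"
  proof (rule flat_locally_holomorphic_eq_0[where Q = Q])
    fix t0
    obtain g e where g: "e > 0" "g holomorphic_on ball (of_real t0) e"
      "\<And>t. \<bar>t - t0\<bar> < e \<Longrightarrow> g (of_real t) = complex_of_real (u (\<gamma> 1 t))"
      using ext[of 1 t0] by auto
    obtain g' e' where g': "e' > 0" "g' holomorphic_on ball (of_real t0) e'"
      "\<And>t. \<bar>t - t0\<bar> < e' \<Longrightarrow> g' (of_real t) = complex_of_real (u (\<gamma> (- 1) t))"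
      using ext[of "- 1" t0] by auto
    have "(\<lambda>z. g z - g' z) holomorphic_on ball (of_real t0) (min e e')"
      using g(2) g'(2) by (intro holomorphic_on_diff) (auto elim: holomorphic_on_subset)
    then show "\<exists>g e. e > 0 \<and> g holomorphic_on ball (of_real t0) e \<and>
        (\<forall>t. \<bar>t - t0\<bar> < e \<longrightarrow> g (of_real t) = complex_of_real (Q t))"
      using g(1,3) g'(1,3) by (intro exI[of _ "\<lambda>z. g z - g' z"] exI[of _ "min e e'"]) (simp add: Q_def)
  next
    fix m
    obtain d where d: "d > 0" "\<And>s. 0 < s \<Longrightarrow> s < d \<Longrightarrow> \<bar>U (p + s *\<^sub>R n) - U (p - s *\<^sub>R n)\<bar> \<le> s ^ m"
      using odd_difference_flat[OF p(1)] by metis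
    have "((\<lambda>t::real. cos t) \<longlongrightarrow> cos 0) (at_right 0)"
      by (intro tendsto_cos tendsto_ident_at)
    from order_tendstoD(1)[OF this, of "1 / 2"]
    have "\<forall>\<^sub>F t in at_right 0. cos t > (1 / 2 :: real)" by simp
    then obtain d' where d': "d' > 0" "\<And>t. 0 < t \<Longrightarrow> t < d' \<Longrightarrow> cos t > (1 / 2 :: real)"
      unfolding eventually_at_right_field by auto
    \<comment> \<open>cos t > 1/2 yields tan t \<le> 2t, whence the constant 2^m and the restriction
      t < d/2; t < 1 keeps sin t positive.\<close>
    have "\<bar>Q t\<bar> \<le> 2 ^ m * t ^ m" if t: "0 < t" "t < min (min d' 1) (d / 2)" for t
    proof -
      have c: "cos t > 1 / 2" using d'(2) t by simp
      have s: "0 < sin t" "sin t \<le> t" using t pi_gt3 by (auto intro: sin_gt_zero sin_x_le_x)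
      have tan: "0 < tan t" "tan t \<le> 2 * t"
      proof -
        show "0 < tan t" using c s by (simp add: tan_def)
        have "t * 1 \<le> t * (2 * cos t)" using c t by (intro mult_left_mono) auto
        then have "sin t \<le> 2 * t * cos t" using s(2) by linarith
        then show "tan t \<le> 2 * t" using c by (simp add: tan_def divide_le_eq)
      qed
      have U_\<gamma>: "U (p + (\<sigma> * tan t) *\<^sub>R n) = u (\<gamma> \<sigma> t)" if "\<sigma> * \<sigma> = 1" for \<sigma>
      proof -
        have "\<gamma> \<sigma> t = cos t *\<^sub>R (p + (\<sigma> * tan t) *\<^sub>R n)"
          using c by (simp add: \<gamma>_def tan_def algebra_simps)
        then have "sgn (\<gamma> \<sigma> t) = sgn (p + (\<sigma> * tan t) *\<^sub>R n)"
          using c by (simp add: sgn_scaleR)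
        moreover have "sgn (\<gamma> \<sigma> t) = \<gamma> \<sigma> t" using \<gamma>[OF that, of t] by (simp add: sgn_div_norm)
        ultimately show ?thesis by simp
      qed
      have "\<bar>Q t\<bar> = \<bar>U (p + tan t *\<^sub>R n) - U (p - tan t *\<^sub>R n)\<bar>"
        using U_\<gamma>[of 1] U_\<gamma>[of "- 1"] by (simp add: Q_def)
      also have "\<dots> \<le> tan t ^ m" using tan t by (intro d(2)) auto
      also have "\<dots> \<le> (2 * t) ^ m" using tan by (intro power_mono) auto
      finally show ?thesis by (simp add: power_mult_distrib)
    qed
    then show "\<exists>K d. d > 0 \<and> (\<forall>t\<in>{0<..<d}. \<bar>Q t\<bar> \<le> K * t ^ m)"
      using d(1) d'(1) by (intro exI[of _ "2 ^ m"] exI[of _ "min (min d' 1) (d / 2)"]) auto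
  qed
  then show ?thesis by (simp add: Q_def \<gamma>_def)
qed

text \<open>A unit vector with nonzero equatorial component lies on the orthogonal great circle
  through a point of the half plane, possibly on its far half. This leaves the points with sin
  \<theta> cos d = 0: the poles are fixed by the reflection, the others are limits.\<close>

lemma reflection_symmetric:
  assumes \<theta>: "\<theta> \<in> {0..pi}"
  shows "u (spherical \<theta> \<psi>) = u (spherical \<theta> (2 * \<phi> - \<psi>))"
proof -
  define R where "R d = u (spherical \<theta> (\<phi> + d)) - u (spherical \<theta> (\<phi> - d))" for d
  have sph: "spherical \<theta> (\<phi> + d) = (sin \<theta> * cos d) *\<^sub>R equatorial \<phi> + (sin \<theta> * sin d) *\<^sub>R n + cos \<theta> *\<^sub>R polar_axis" for d
    using spherical_eq_frame[of \<theta> "\<phi> + d" \<phi>] by simp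
  have main: "u (x + c *\<^sub>R n) = u (x - c *\<^sub>R n)"
    if x: "x = a *\<^sub>R equatorial \<phi> + b *\<^sub>R polar_axis" and a: "a \<noteq> 0" and norm: "norm (x + c *\<^sub>R n) = 1"
    for x a b c
  proof -
    \<comment> \<open>The sign moves x into the half plane. It reappears as the sign of cos t, so
      points beyond t = \<pi>/2 are covered.\<close>
    define \<sigma> where "\<sigma> = sgn a"
    have \<sigma>: "\<sigma> * \<sigma> = 1" "\<sigma> * a > 0" using a by (auto simp: \<sigma>_def sgn_if)
    define r where "r = norm x"
    have xH: "\<sigma> *\<^sub>R x \<in> half_plane \<phi>"
      unfolding half_plane_def x using \<sigma>(2)
      by (intro CollectI exI[of _ "\<sigma> * a"] exI[of _ "\<sigma> * b"]) (simp add: scaleR_add_right)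
    have r: "r > 0" using half_plane_nonzero[OF xH] by (auto simp: r_def)
    define p where "p = (\<sigma> / r) *\<^sub>R x"
    have "\<bar>\<sigma>\<bar> = 1" using a by (simp add: \<sigma>_def abs_sgn_eq)
    then have p: "norm p = 1" using r by (simp add: p_def r_def)
    have pH: "p \<in> half_plane \<phi>"
      unfolding half_plane_def p_def x using \<sigma>(2) r
      by (intro CollectI exI[of _ "\<sigma> / r * a"] exI[of _ "\<sigma> / r * b"]) (simp add: scaleR_add_right)
    have x_p: "x = (\<sigma> * r) *\<^sub>R p" using \<sigma>(1) r by (simp add: p_def)
    have "x \<bullet> n = 0" by (simp add: x inner_add_left)
    then have "(x + c *\<^sub>R n) \<bullet> (x + c *\<^sub>R n) = r\<^sup>2 + c\<^sup>2"
      by (simp add: inner_add_left inner_add_right inner_commute r_def power2_norm_eq_inner power2_eq_square[of c])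
    then have "(\<sigma> * r)\<^sup>2 + c\<^sup>2 = 1"
      using norm \<sigma>(1) by (simp add: norm_eq_1 power_mult_distrib power2_eq_square[of \<sigma>])
    then obtain t where "\<sigma> * r = cos t" "c = sin t"
      using sincos_total_2pi by metis
    then show ?thesis using great_circle_symmetric[OF pH p, of t] x_p by simp
  qed
  have R0: "R d = 0" if "sin \<theta> * cos d \<noteq> 0" for d
  proof -
    have "spherical \<theta> (\<phi> + d) = ((sin \<theta> * cos d) *\<^sub>R equatorial \<phi> + cos \<theta> *\<^sub>R polar_axis) + (sin \<theta> * sin d) *\<^sub>R n"
      "spherical \<theta> (\<phi> - d) = ((sin \<theta> * cos d) *\<^sub>R equatorial \<phi> + cos \<theta> *\<^sub>R polar_axis) - (sin \<theta> * sin d) *\<^sub>R n"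
      using sph[of d] sph[of "- d"] by (simp_all add: algebra_simps)
    then show ?thesis
      using main[OF refl that, of "cos \<theta>" "sin \<theta> * sin d"] norm_spherical[of \<theta> "\<phi> + d"] by (simp add: R_def)
  qed
  have "R d = 0" for d
  proof (cases "sin \<theta> = 0")
    case True
    then show ?thesis using sph[of d] sph[of "- d"] by (simp add: R_def)
  next
    case False
    have cont: "continuous_on UNIV R"
    proof -
      have "continuous_on (- {0}) U" by (rule smooth_on_imp_continuous_on[OF smooth_U])
      moreover have "continuous_on UNIV (\<lambda>d. spherical \<theta> (\<phi> + d))"
        unfolding sph by (intro continuous_intros)
      ultimately have "continuous_on UNIV (\<lambda>d. U (spherical \<theta> (\<phi> + d)))"
        by (rule continuous_on_compose2) (use spherical_nonzero in auto)
      then have c: "continuous_on UNIV (\<lambda>d. u (spherical \<theta> (\<phi> + d)))" by (simp add: sgn_div_norm)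
      have "continuous_on UNIV (\<lambda>d. u (spherical \<theta> (\<phi> + (- d))))"
        by (rule continuous_on_compose2[OF c]) (auto intro!: continuous_intros)
      with c show ?thesis unfolding R_def by (auto intro!: continuous_intros)
    qed
    show ?thesis
    proof (cases "cos d = 0")
      case False
      then show ?thesis using R0 \<open>sin \<theta> \<noteq> 0\<close> by simp
    next
      case True
      \<comment> \<open>Zeros of cos are isolated: cos does not vanish on (d, d + \<pi>), so R is 0
        just to the right of d.\<close>
      have "(R \<longlongrightarrow> R d) (at_right d)"
        using cont by (simp add: continuous_on_eq_continuous_at isCont_def filterlim_at_split)
      moreover have "\<forall>\<^sub>F x in at_right d. R x = 0"
        using eventually_at_right_real[of d "d + pi"]
      proof (rule eventually_mono)
        fix x assume x: "x \<in> {d<..<d + pi}"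
        have "cos x = cos (d + (x - d))" by simp
        also have "\<dots> = - sin d * sin (x - d)" unfolding cos_add using True by simp
        finally have "cos x = - sin d * sin (x - d)" .
        moreover have "sin d \<noteq> 0" using True sin_zero_abs_cos_one by fastforce
        moreover have "sin (x - d) > 0" using x by (intro sin_gt_zero) auto
        ultimately show "R x = 0" using R0 \<open>sin \<theta> \<noteq> 0\<close> by simp
      qed simp
      then have "(R \<longlongrightarrow> 0) (at_right d)" by (rule tendsto_eventually)
      ultimately show ?thesis by (rule tendsto_unique[OF trivial_limit_at_right_real])
    qed
  qed
  from this[of "\<psi> - \<phi>"] show ?thesis by (simp add: R_def algebra_simps)
qed

lemma axial_extremum_reflect:
  assumes "axial_extremum u \<psi>"
  shows "axial_extremum u (2 * \<phi> - \<psi>)"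
  unfolding axial_extremum_def
proof
  fix \<theta> assume \<theta>: "\<theta> \<in> {0..pi}"
  let ?f = "\<lambda>x. u (spherical \<theta> x)"
  have "DERIV ?f x :> D \<Longrightarrow> DERIV ?f (2 * \<phi> - x) :> - D" for x D
  proof -
    assume D: "DERIV ?f x :> D"
    have "((\<lambda>y. ?f (2 * \<phi> - y)) has_real_derivative D * (- 1)) (at (2 * \<phi> - x))"
      by (rule DERIV_chain2[where g = "\<lambda>y. 2 * \<phi> - y" and f = ?f])
        (use D in \<open>auto intro!: derivative_eq_intros\<close>)
    then show ?thesis using reflection_symmetric[OF \<theta>] by simp
  qed
  note refl_deriv = this
  have "(\<lambda>y. U (spherical \<theta> y)) = ?f" by (simp add: sgn_div_norm)
  moreover note spherical_nonzero[of \<theta> \<psi>]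
  moreover have "((\<lambda>y. spherical \<theta> y) has_derivative (\<lambda>t. t *\<^sub>R (sin \<theta> *\<^sub>R azimuthal \<psi>))) (at \<psi>)"
    unfolding spherical_eq_frame[of \<theta> _ \<psi>] by (auto intro!: derivative_eq_intros)
  \<comment> \<open>A value of \<open>deriv\<close> says something only where the derivative exists,
    so differentiability at \<psi> is secured before the chain rule transports the value 0.\<close>
  ultimately have "?f differentiable at \<psi>"
    using differentiable_compose[of U "\<lambda>y. spherical \<theta> y" \<psi> UNIV] smooth_on_imp_differentiable[OF smooth_U]
    by (auto intro: differentiableI)
  then have "DERIV ?f \<psi> :> deriv ?f \<psi>"
    by (simp add: DERIV_deriv_iff_real_differentiable)
  from DERIV_imp_deriv[OF refl_deriv[OF this]] assms \<theta>
  show "deriv_azimuth u \<theta> (2 * \<phi> - \<psi>) = 0"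
    by (simp add: axial_extremum_def deriv_azimuth_def)
qed

end

section \<open>Spacing of the axial extrema\<close>

lemma enumerates_axial_extrema_gap:
  assumes enum: "enumerates_axial_extrema u N \<phi>" and i: "i \<in> {1..N}"
  shows "\<phi> i < \<phi> (i + 1)" "axial_extremum u (\<phi> i)" "axial_extremum u (\<phi> (i + 1))"
    "\<And>x. axial_extremum u x \<Longrightarrow> \<phi> i < x \<Longrightarrow> \<phi> (i + 1) \<le> x"
proof -
  have mono: "strict_mono_on {1..N} \<phi>" and period: "\<phi> N < \<phi> 1 + 2 * pi"
    and last: "\<phi> (N + 1) = \<phi> 1 + 2 * pi"
    and E: "axial_extremum u x \<longleftrightarrow> (\<exists>j\<in>{1..N}. \<exists>k::int. x = \<phi> j + 2 * pi * of_int k)" for x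
    using enum unfolding enumerates_axial_extrema_def by (auto simp: set_eq_iff)
  have le: "\<phi> j \<le> \<phi> k" if "j \<in> {1..N}" "k \<in> {1..N}" "j \<le> k" for j k
    using strict_mono_onD[OF mono that(1,2)] that(3) by (cases "j = k") auto
  have less: "\<phi> j < \<phi> k \<longleftrightarrow> j < k" if "j \<in> {1..N}" "k \<in> {1..N}" for j k
    using strict_mono_onD[OF mono that] le[OF that(2,1)] by (meson linorder_not_le)
  have N: "1 \<in> {1..N}" "N \<in> {1..N}" using i by auto
  show ext_i: "axial_extremum u (\<phi> i)"
    unfolding E using i by (intro bexI[of _ i] exI[of _ 0]) auto
  show "\<phi> i < \<phi> (i + 1)"
    using i period last le[OF i N(2)] less[of i "i + 1"] by (cases "i = N") auto
  show "axial_extremum u (\<phi> (i + 1))"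
  proof (cases "i = N")
    case True
    show ?thesis unfolding E True last by (rule bexI[OF _ N(1)], rule exI[of _ 1]) simp
  next
    case False
    then show ?thesis unfolding E using i by (intro bexI[of _ "i + 1"] exI[of _ 0]) auto
  qed
  have next_le: "\<phi> (i + 1) \<le> \<phi> 1 + 2 * pi"
    using i last period le[of "i + 1" N] by (cases "i = N") auto
  fix x assume "axial_extremum u x" and x: "\<phi> i < x"
  then obtain j k where j: "j \<in> {1..N}" and x_eq: "x = \<phi> j + 2 * pi * of_int k"
    unfolding E by blast
  \<comment> \<open>For k \<ge> 1 the point lies at or beyond \<phi> 1 + 2\<pi>, for k \<le> -1 it
    lies below \<phi> 1; only k = 0 depends on the order of the list.\<close>
  consider "k \<ge> 1" | "k = 0" | "k \<le> - 1" by linarith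
  then show "\<phi> (i + 1) \<le> x"
  proof cases
    case 1
    then have "2 * pi * 1 \<le> 2 * pi * of_int k" by (intro mult_left_mono) auto
    moreover have "\<phi> 1 \<le> \<phi> j" using j by (intro le N) auto
    ultimately show ?thesis using next_le x_eq by linarith
  next
    case 2
    then have "i < j" using x x_eq less[OF i j] by simp
    then show ?thesis using le[of "i + 1" j] i j 2 x_eq by auto
  next
    case 3
    then have "real_of_int k \<le> - 1" by linarith
    then have "2 * pi * of_int k \<le> 2 * pi * (- 1)" by (intro mult_left_mono) auto
    moreover have "\<phi> j \<le> \<phi> N" "\<phi> 1 \<le> \<phi> i" using i j by (auto intro!: le)
    ultimately show ?thesis using period x x_eq by linarith
  qed
qed

lemma axial_extremum_shift:
  "axial_extremum u (\<psi> + 2 * pi) \<longleftrightarrow> axial_extremum u \<psi>"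
proof -
  have periodic: "spherical \<theta> (x + 2 * pi) = spherical \<theta> x" for \<theta> x
    by (simp add: spherical_def)
  have "deriv_azimuth u \<theta> (\<psi> + 2 * pi) = deriv_azimuth u \<theta> \<psi>" for \<theta>
  proof -
    have "(\<lambda>x. u (spherical \<theta> (x + 2 * pi))) = (\<lambda>x. u (spherical \<theta> x))"
      by (simp only: periodic)
    then have "DERIV (\<lambda>x. u (spherical \<theta> x)) (\<psi> + 2 * pi) :> D \<longleftrightarrow> DERIV (\<lambda>x. u (spherical \<theta> x)) \<psi> :> D" for D
      using DERIV_shift[of "\<lambda>x. u (spherical \<theta> x)" D \<psi> "2 * pi"] by simp
    then show ?thesis unfolding deriv_azimuth_def deriv_def by simp
  qed
  then show ?thesis by (simp add: axial_extremum_def)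
qed

theorem theorem1p1:
  fixes F :: "real \<Rightarrow> real \<Rightarrow> real" and \<delta> :: real
    and u :: "real^3 \<Rightarrow> real" and N :: nat and \<phi> :: "nat \<Rightarrow> real"
  assumes F_analytic: "real_analytic_on (\<lambda>(a, q). F a q) UNIV"
    and elliptic: "\<delta> > 0" "\<And>a q. deriv (\<lambda>s. F a s) q \<ge> \<delta>"
    and u_analytic: "real_analytic_on u (sphere 0 1)"
    and nonconstant: "\<not> u constant_on sphere 0 1"
    and solution: "\<And>x. x \<in> sphere 0 1 \<Longrightarrow> 0 = F (u x) (laplace_beltrami u x)"
    and axial: "only_axial_extrema u"
    and enum: "enumerates_axial_extrema u N \<phi>"
    and lev: "leveled u"
  shows "\<forall>i\<in>{1..N}.
      \<phi> i = (\<phi> (i - 1) + \<phi> (i + 1)) / 2 \<and>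
      (\<forall>\<theta>\<in>{0..pi}. \<forall>\<psi>\<in>{\<phi> (i - 1)..\<phi> i}.
        u (spherical \<theta> \<psi>) = u (spherical \<theta> (2 * \<phi> i - \<psi>)))"
proof (intro ballI conjI)
  fix i assume i: "i \<in> {1..N}"
  note gap = enumerates_axial_extrema_gap[OF enum]
  have reflect: "axial_extremum u (2 * \<phi> i - \<psi>)" if "axial_extremum u \<psi>" for \<psi>
    by (rule axial_extremum_reflect[OF F_analytic elliptic u_analytic _ gap(2)[OF i] that])
      (rule solution)
  show "u (spherical \<theta> \<psi>) = u (spherical \<theta> (2 * \<phi> i - \<psi>))" if "\<theta> \<in> {0..pi}" for \<theta> \<psi>
    by (rule reflection_symmetric[OF F_analytic elliptic u_analytic _ gap(2)[OF i] that])
      (rule solution)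
  \<comment> \<open>The entry before the first is \<phi> N - 2\<pi>, so for i = 1 this is the gap
    after \<phi> N moved back by one period.\<close>
  have prev: "\<phi> (i - 1) < \<phi> i \<and> axial_extremum u (\<phi> (i - 1)) \<and>
      (\<forall>x. axial_extremum u x \<longrightarrow> \<phi> (i - 1) < x \<longrightarrow> \<phi> i \<le> x)"
  proof (cases "i = 1")
    case True
    have N: "N \<in> {1..N}" using i by auto
    have ends: "\<phi> 0 = \<phi> N - 2 * pi" "\<phi> (N + 1) = \<phi> 1 + 2 * pi"
      using enum unfolding enumerates_axial_extrema_def by auto
    have "axial_extremum u (\<phi> 0)"
      using gap(2)[OF N] axial_extremum_shift[of u "\<phi> 0"] ends by simp
    moreover have "\<phi> 1 \<le> x" if "axial_extremum u x" "\<phi> 0 < x" for x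
      using gap(4)[OF N, of "x + 2 * pi"] axial_extremum_shift[of u x] that ends by simp
    ultimately show ?thesis using gap(1)[OF N] ends True by simp
  next
    case False
    then have "i - 1 \<in> {1..N}" "i - 1 + 1 = i" using i by auto
    then show ?thesis using gap(1,2,4)[of "i - 1"] by simp
  qed
  \<comment> \<open>Reflection maps extrema to extrema. The image of the predecessor lies beyond
    \<phi> i, hence not before the successor; the image of the successor lies below \<phi> i, hence
    not after the predecessor. The two inequalities together give the midpoint.\<close>
  have "\<phi> (i + 1) \<le> 2 * \<phi> i - \<phi> (i - 1)"
    using prev by (intro gap(4)[OF i] reflect) auto
  moreover have "\<phi> i \<le> 2 * \<phi> i - \<phi> (i + 1)" if "\<phi> (i - 1) < 2 * \<phi> i - \<phi> (i + 1)"
    using prev that reflect[OF gap(3)[OF i]] by blast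
  ultimately show "\<phi> i = (\<phi> (i - 1) + \<phi> (i + 1)) / 2"
    using gap(1)[OF i] by (cases "\<phi> (i - 1) < 2 * \<phi> i - \<phi> (i + 1)") (auto simp: field_simps)
qed

end
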